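(* Let $a,b,c,d\in\mathbb{R}$ satisfy (C0) together with (C1) or (C2), and let $\nu=1$ (complete dissipation). For any $\delta>0$ there exists $\beta>0$ such that, if $\mathrm{supp}(\widehat Y_0)\subset\mathbb{R}\setminus[-\delta,\delta]$, then for any $t>0$ $$E(t)\le \exp(-2\beta t)\,\|Y_0\|_{L^2(\mathbb{R})}^2 .$$ In addition: (i) if $\mathrm{order}(\sigma)\le 0$, the system is in the BBM--Burgers class; namely, there exist positive constants $\delta_M,\beta,C$ such that for all $|\xi|>\delta_M$ and $t>0$, $\ \|\exp(-tA(\xi))\|\le C e^{-\beta t}$; (ii) if $\mathrm{order}(\sigma)\ge 1$, the system is in the KdV--Burgers class; namely, there exist positive constants $\delta_M,\beta,C$ such that for all $|\xi|>\delta_M$ and $t>0$, $\ \|\exp(-tA(\xi))\|\le C e^{-\beta\xi^2 t}$.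
   Context: Conditions on the real constants: (C0) $a+b+c+d=\frac13$ and $c+d=\frac12(1-\theta^2)\ge 0$ for some $\theta\in[0,1]$; (C1) $b\ge0,\ d\ge0,\ a\le0,\ c\le0$; (C2) $b\ge0,\ d\ge0,\ a=c>0$. Linear system: $\eta_t+u_x+au_{xxx}-b\eta_{xxt}=\nu\eta_{xx}$, $u_t+\eta_x+c\eta_{xxx}-du_{xxt}=u_{xx}$ (here $\nu=1$), $x\in\mathbb{R}$. Put $\omega_1=\frac{1-a\xi^2}{1+b\xi^2}$, $\omega_2=\frac{1-c\xi^2}{1+d\xi^2}$, $\sigma=(\omega_1\omega_2)^{1/2}$, $\widehat H=(\omega_1/\omega_2)^{1/2}$ (with $0/0=1$), $\alpha=\frac{\xi^2}{1+b\xi^2}$, $\varepsilon=\frac{\xi^2}{1+d\xi^2}$. With $Y=(\eta,w)$, $\widehat w=\widehat H\widehat u$, the system reads $\widehat Y_t+A(\xi)\widehat Y=0$, $A(\xi)=\begin{pmatrix}\nu\alpha & i\,\mathrm{sgn}(\omega_1)\xi\sigma\\ i\,\mathrm{sgn}(\omega_2)\xi\sigma&\varepsilon\end{pmatrix}$, so $\widehat Y(t,\xi)=e^{-tA(\xi)}\widehat Y_0(\xi)$, where $Y_0$ is the initial datum (in $L^2$). $E(t)=\int_{\mathbb{R}}|\widehat Y(t,\xi)|^2d\xi$. The Fourier transform is the unitary one, $\widehat f(\xi)=(2\pi)^{-1/2}\int e^{-ix\xi}f(x)\,dx$. $\|\cdot\|$ is the operator norm of $2\times2$ complex matrices for the Euclidean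 norm. The order of a nonnegative function $\kappa(\xi)$ is the number $m$ with $\kappa(\xi)\sim C|\xi|^m$ as $|\xi|\to\infty$ for some $C>0$; thus $\mathrm{order}(\sigma)=\{a\}+\{c\}-\{b\}-\{d\}$, with $\{r\}=1$ if $r\neq0$, $\{0\}=0$. Classes: the dichotomy property is the existence of constants $\beta,C>0$ and $\delta_m\in(0,+\infty]$ such that for all $t>0$: $\|e^{-tA(\xi)}\|\le Ce^{-\beta t\xi^2}$ for $|\xi|\le\delta_m$, and $\|e^{-tA(\xi)}\|\le Ce^{-\beta t}$ for $|\xi|>\delta_m$. A system with this property is in the KdV--Burgers class if $\delta_m=+\infty$ is feasible (for some $\beta,C>0$), and in the BBM--Burgers class otherwise. *)

theory Defs
  imports "HOL-Analysis.Analysis" "HOL-Library.Landau_Symbols"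
begin

section \<open>Conditions on the coefficients\<close>

definition cond_C0 :: "real \<Rightarrow> real \<Rightarrow> real \<Rightarrow> real \<Rightarrow> bool" where
  "cond_C0 a b c d \<longleftrightarrow>
     a + b + c + d = 1 / 3 \<and> (\<exists>\<theta>\<in>{0..1}. c + d = (1 - \<theta>\<^sup>2) / 2) \<and> c + d \<ge> 0"

definition cond_C1 :: "real \<Rightarrow> real \<Rightarrow> real \<Rightarrow> real \<Rightarrow> bool" where
  "cond_C1 a b c d \<longleftrightarrow> b \<ge> 0 \<and> d \<ge> 0 \<and> a \<le> 0 \<and> c \<le> 0"

definition cond_C2 :: "real \<Rightarrow> real \<Rightarrow> real \<Rightarrow> real \<Rightarrow> bool" where
  "cond_C2 a b c d \<longleftrightarrow> b \<ge> 0 \<and> d \<ge> 0 \<and> a = c \<and> a > 0"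

section \<open>The symbol of the linear system\<close>

definition \<omega>\<^sub>1 :: "real \<Rightarrow> real \<Rightarrow> real \<Rightarrow> real" where
  "\<omega>\<^sub>1 a b \<xi> = (1 - a * \<xi>\<^sup>2) / (1 + b * \<xi>\<^sup>2)"

definition \<omega>\<^sub>2 :: "real \<Rightarrow> real \<Rightarrow> real \<Rightarrow> real" where
  "\<omega>\<^sub>2 c d \<xi> = (1 - c * \<xi>\<^sup>2) / (1 + d * \<xi>\<^sup>2)"

definition \<sigma> :: "real \<Rightarrow> real \<Rightarrow> real \<Rightarrow> real \<Rightarrow> real \<Rightarrow> real" where
  "\<sigma> a b c d \<xi> = sqrt (\<omega>\<^sub>1 a b \<xi> * \<omega>\<^sub>2 c d \<xi>)"

definition \<alpha> :: "real \<Rightarrow> real \<Rightarrow> real" where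
  "\<alpha> b \<xi> = \<xi>\<^sup>2 / (1 + b * \<xi>\<^sup>2)"

definition \<epsilon> :: "real \<Rightarrow> real \<Rightarrow> real" where
  "\<epsilon> d \<xi> = \<xi>\<^sup>2 / (1 + d * \<xi>\<^sup>2)"

text \<open>
  The Fourier transform in \<open>x\<close> of the system
  \<open>\<eta>\<^sub>t + u\<^sub>x + a u\<^sub>x\<^sub>x\<^sub>x - b \<eta>\<^sub>x\<^sub>x\<^sub>t = \<nu> \<eta>\<^sub>x\<^sub>x\<close>,
  \<open>u\<^sub>t + \<eta>\<^sub>x + c \<eta>\<^sub>x\<^sub>x\<^sub>x - d u\<^sub>x\<^sub>x\<^sub>t = u\<^sub>x\<^sub>x\<close>,
  written in the unknown \<open>Y = (\<eta>, w)\<close> whose second component has transform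
  \<open>(\<omega>\<^sub>1 / \<omega>\<^sub>2)\<^bsup>1/2\<^esup>\<close> times that of \<open>u\<close> (with \<open>0 / 0 = 1\<close>), is
  \<open>Y\<^sub>t + A(\<xi>) Y = 0\<close> with the following matrix.
\<close>

definition A :: "real \<Rightarrow> real \<Rightarrow> real \<Rightarrow> real \<Rightarrow> real \<Rightarrow> real \<Rightarrow> complex^2^2" where
  "A \<nu> a b c d \<xi> = vector
     [vector [of_real (\<nu> * \<alpha> b \<xi>), \<i> * of_real (sgn (\<omega>\<^sub>1 a b \<xi>) * \<xi> * \<sigma> a b c d \<xi>)],
      vector [\<i> * of_real (sgn (\<omega>\<^sub>2 c d \<xi>) * \<xi> * \<sigma> a b c d \<xi>), of_real (\<epsilon> d \<xi>)]]"

section \<open>Matrix exponential and operator norm\<close>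

text \<open>
  The library function \<open>exp\<close> is not available on \<open>complex^2^2\<close>: the type's multiplication, where
  defined, is componentwise, so the powers are taken with respect to \<open>**\<close>.
\<close>

definition mexp :: "complex^'n^'n \<Rightarrow> complex^'n^'n" where
  "mexp M = (\<Sum>k. (1 / fact k) *\<^sub>R (((**) M) ^^ k) (mat 1))"

text \<open>The type's own norm on \<open>complex^'n^'n\<close> is the Frobenius norm, not the operator norm.\<close>

definition opnorm :: "complex^'n^'n \<Rightarrow> real" where
  "opnorm M = onorm (\<lambda>v. M *v v)"

section \<open>Fourier transform on \<open>L\<^sup>2\<close>\<close>

definition L2 :: "(real \<Rightarrow> 'a::euclidean_space) \<Rightarrow> bool" where
  "L2 f \<longleftrightarrow> f \<in> borel_measurable lborel \<and> integrable lborel (\<lambda>x. (norm (f x))\<^sup>2)"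

definition L2_norm :: "(real \<Rightarrow> 'a::euclidean_space) \<Rightarrow> real" where
  "L2_norm f = sqrt (LINT x|lborel. (norm (f x))\<^sup>2)"

definition truncated_fourier :: "real \<Rightarrow> (real \<Rightarrow> complex) \<Rightarrow> real \<Rightarrow> complex" where
  "truncated_fourier R f \<xi> =
     of_real (1 / sqrt (2 * pi)) * (LINT x:{-R..R}|lborel. exp (- \<i> * of_real (x * \<xi>)) * f x)"

text \<open>
  The integral defining the unitary Fourier transform need not converge for \<open>f\<close> in \<open>L\<^sup>2\<close>; the
  transform is the limit in \<open>L\<^sup>2\<close> of the transforms of the truncations of \<open>f\<close>. It is determined
  almost everywhere only, hence a relation; \<open>g\<close> ranges over all representatives.
\<close>

definition has_L2_fourier :: "(real \<Rightarrow> complex) \<Rightarrow> (real \<Rightarrow> complex) \<Rightarrow> bool" where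
  "has_L2_fourier f g \<longleftrightarrow> L2 f \<and> L2 g \<and>
     ((\<lambda>R. \<integral>\<^sup>+ \<xi>. ennreal ((norm (truncated_fourier R f \<xi> - g \<xi>))\<^sup>2) \<partial>lborel) \<longlongrightarrow> 0) at_top"

definition has_L2_fourier_vec :: "(real \<Rightarrow> complex^2) \<Rightarrow> (real \<Rightarrow> complex^2) \<Rightarrow> bool" where
  "has_L2_fourier_vec f g \<longleftrightarrow> (\<forall>j. has_L2_fourier (\<lambda>x. f x $ j) (\<lambda>\<xi>. g \<xi> $ j))"

text \<open>
  Support of an almost-everywhere class: the complement of the largest open set on which the
  function vanishes almost everywhere.
\<close>

definition ess_support :: "(real \<Rightarrow> 'a::euclidean_space) \<Rightarrow> real set" where
  "ess_support f = - \<Union>{U. open U \<and> (AE \<xi> in lborel. \<xi> \<in> U \<longrightarrow> f \<xi> = 0)}"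

section \<open>Energy of the solution\<close>

definition Y_hat ::
  "real \<Rightarrow> real \<Rightarrow> real \<Rightarrow> real \<Rightarrow> real \<Rightarrow> (real \<Rightarrow> complex^2) \<Rightarrow> real \<Rightarrow> real \<Rightarrow> complex^2" where
  "Y_hat \<nu> a b c d Y0_hat t \<xi> = mexp (- (t *\<^sub>R A \<nu> a b c d \<xi>)) *v Y0_hat \<xi>"

text \<open>Valued in \<open>ennreal\<close>, so that a bound on the energy includes its finiteness.\<close>

definition energy ::
  "real \<Rightarrow> real \<Rightarrow> real \<Rightarrow> real \<Rightarrow> real \<Rightarrow> (real \<Rightarrow> complex^2) \<Rightarrow> real \<Rightarrow> ennreal" where
  "energy \<nu> a b c d Y0_hat t =
     (\<integral>\<^sup>+ \<xi>. ennreal ((norm (Y_hat \<nu> a b c d Y0_hat t \<xi>))\<^sup>2) \<partial>lborel)"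

section \<open>Order at infinity, and the two classes of systems\<close>

text \<open>On \<open>real\<close>, the filter \<open>at_infinity\<close> is \<open>\<bar>\<xi>\<bar> \<rightarrow> \<infinity>\<close>, i.e. both ends.\<close>

definition has_growth_order :: "(real \<Rightarrow> real) \<Rightarrow> real \<Rightarrow> bool" where
  "has_growth_order \<kappa> m \<longleftrightarrow> (\<exists>C>0. \<kappa> \<sim>[at_infinity] (\<lambda>\<xi>. C * \<bar>\<xi>\<bar> powr m))"

definition growth_order :: "(real \<Rightarrow> real) \<Rightarrow> real" where
  "growth_order \<kappa> = (THE m. has_growth_order \<kappa> m)"

text \<open>Here and below \<open>B\<close> stands for the matrix symbol \<open>\<xi> \<mapsto> A(\<xi>)\<close> of a system.\<close>

definition dichotomy :: "(real \<Rightarrow> complex^2^2) \<Rightarrow> real \<Rightarrow> real \<Rightarrow> ereal \<Rightarrow> bool" where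
  "dichotomy B \<beta> C \<delta>m \<longleftrightarrow> \<beta> > 0 \<and> C > 0 \<and> \<delta>m > 0 \<and>
     (\<forall>t>0. \<forall>\<xi>.
        (ereal \<bar>\<xi>\<bar> \<le> \<delta>m \<longrightarrow> opnorm (mexp (- (t *\<^sub>R B \<xi>))) \<le> C * exp (- \<beta> * t * \<xi>\<^sup>2)) \<and>
        (ereal \<bar>\<xi>\<bar> > \<delta>m \<longrightarrow> opnorm (mexp (- (t *\<^sub>R B \<xi>))) \<le> C * exp (- \<beta> * t)))"

definition KdV_Burgers_class :: "(real \<Rightarrow> complex^2^2) \<Rightarrow> bool" where
  "KdV_Burgers_class B \<longleftrightarrow> (\<exists>\<beta> C. dichotomy B \<beta> C \<infinity>)"

definition BBM_Burgers_class :: "(real \<Rightarrow> complex^2^2) \<Rightarrow> bool" where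
  "BBM_Burgers_class B \<longleftrightarrow> (\<exists>\<beta> C \<delta>m. dichotomy B \<beta> C \<delta>m) \<and> \<not> KdV_Burgers_class B"

end

theory Submission
  imports Defs "HOL-Probability.Characteristic_Functions"
begin

text \<open>
  Under both sign conditions \<open>\<omega>\<^sub>1\<close> and \<open>\<omega>\<^sub>2\<close> have the same sign, so the symbol is
  \<open>A(\<xi>) = ((\<alpha>, i \<tau>), (i \<tau>, \<epsilon>))\<close> with \<open>\<tau>\<close> real and \<open>\<bar>\<tau>\<bar> = \<bar>\<xi>\<bar> \<sigma>\<close>. The coupling \<open>i \<tau>\<close> is
  skew-adjoint, hence \<open>\<parallel>e\<^bsup>-tA\<^esup>\<parallel> \<le> e\<^bsup>-t min(\<alpha>, \<epsilon>)\<^esup>\<close> (\<open>opnorm_contraction\<close>). As \<open>min(\<alpha>, \<epsilon>)\<close> is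
  comparable to \<open>\<xi>\<^sup>2\<close> for bounded \<open>\<xi>\<close> and bounded below by a positive constant for \<open>\<xi>\<close> away from
  \<open>0\<close>, this gives the dichotomy property in every case, the estimate in (i), and the pointwise
  estimate behind the energy decay. For the latter only the inequality \<open>\<parallel>f^\<parallel> \<le> \<parallel>f\<parallel>\<close> in Plancherel's
  theorem is needed (\<open>L2_fourier_vec_bessel\<close>): it is proved for integrable functions by weighting
  with a Gaussian, and passes to the limit in \<open>L\<^sup>2\<close>.

  The size of the coupling at infinity decides between the two classes.

  If \<open>order(\<sigma>) \<le> 0\<close>, then \<open>\<sigma>\<close> is bounded, and \<open>b\<close> and \<open>d\<close> are not both zero, because otherwise all
  four coefficients would vanish, whereas their sum is \<open>1/3\<close>. Thus
  \<open>det A = \<alpha> \<epsilon> + \<xi>\<^sup>2 \<sigma>\<^sup>2 = O(\<xi>\<^sup>2)\<close>. A decay rate \<open>\<kappa>\<close> of \<open>e\<^bsup>-tA\<^esup>\<close> is a lower bound for the real parts of both eigenvalues, so that \<open>\<kappa>\<^sup>2 \<le> \<bar>det A\<bar>\<close>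
  (\<open>decay_rate_sq_le_norm_det\<close>); the rate \<open>\<beta> \<xi>\<^sup>2\<close> would give \<open>\<beta>\<^sup>2 \<xi>\<^sup>4 = O(\<xi>\<^sup>2)\<close>, which is absurd.

  If \<open>order(\<sigma>) \<ge> 1\<close>, either \<open>b = d = 0\<close> and \<open>\<alpha> = \<epsilon> = \<xi>\<^sup>2\<close>, or the order is \<open>1\<close> and exactly one of
  \<open>\<alpha>\<close> and \<open>\<epsilon>\<close> is \<open>\<xi>\<^sup>2\<close>, while \<open>\<bar>\<tau>\<bar>\<close> is comparable to \<open>\<xi>\<^sup>2\<close>. In the second case the coupling is
  strong enough to pass the parabolic damping on to the other component. This is seen on the
  Lyapunov functional \<open>\<bar>y\<^sub>1\<bar>\<^sup>2 + \<bar>y\<^sub>2\<bar>\<^sup>2 + 2 \<gamma> Im(y\<^sub>2 cnj y\<^sub>1)\<close> with a small \<open>\<gamma>\<close>, whose sign moves the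
  damping into the component that lacks it (\<open>opnorm_parabolic_decay\<close>). Unlike a diagonalisation,
  this gives constants that are uniform even where the two eigenvalues of \<open>A(\<xi>)\<close> approach each other.
\<close>

section \<open>The matrix exponential as a power series\<close>

lemma bilinear_matrix_mult: "bilinear ((**) :: complex^'m^'n \<Rightarrow> complex^'k^'m \<Rightarrow> complex^'k^'n)"
  unfolding bilinear_def
  by (auto intro!: linearI
      simp: vec_eq_iff matrix_matrix_mult_def algebra_simps sum.distrib scaleR_sum_right)

lemma bilinear_matrix_vector_mult: "bilinear ((*v) :: complex^'m^'n \<Rightarrow> complex^'m \<Rightarrow> complex^'n)"
  unfolding bilinear_def
  by (auto intro!: linearI
      simp: vec_eq_iff matrix_vector_mult_def algebra_simps sum.distrib scaleR_sum_right)

lemma bounded_linear_matrix_vector_mult: "bounded_linear ((*v) (M :: complex^'m^'n))"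
  using bilinear_matrix_vector_mult[where 'm = 'm and 'n = 'n] unfolding bilinear_def
  by (simp add: linear_conv_bounded_linear)

lemmas matrix_mult_scaleR =
  bilinear_lmul[OF bilinear_matrix_mult] bilinear_rmul[OF bilinear_matrix_mult]

lemmas scaleR_matrix_apply = bilinear_lmul[OF bilinear_matrix_vector_mult]

definition mpow :: "complex^'n^'n \<Rightarrow> nat \<Rightarrow> complex^'n^'n" where
  "mpow M k = (((**) M) ^^ k) (mat 1)"

lemma mpow_0 [simp]: "mpow M 0 = mat 1"
  and mpow_Suc [simp]: "mpow M (Suc k) = M ** mpow M k"
  by (simp_all add: mpow_def)

lemma mpow_scaleR: "mpow (t *\<^sub>R M) k = t ^ k *\<^sub>R mpow M k"
proof (induction k)
  case (Suc k)
  then show ?case by (simp add: matrix_mult_scaleR mult.commute)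
qed simp

lemma mpow_eigenvector:
  assumes "M *v v = \<mu> *s v"
  shows "mpow M k *v v = \<mu> ^ k *s v"
proof (induction k)
  case (Suc k)
  have "mpow M (Suc k) *v v = M *v (\<mu> ^ k *s v)"
    by (simp add: Suc matrix_vector_mul_assoc[symmetric])
  also have "\<dots> = \<mu> ^ k *s (M *v v)"
    by (simp add: vec_eq_iff matrix_vector_mult_def sum_distrib_left mult_ac)
  finally show ?case by (simp add: assms mult_ac)
qed simp

text \<open>
  Any bound \<open>\<parallel>x y\<parallel> \<le> B \<parallel>x\<parallel> \<parallel>y\<parallel>\<close>, as bilinearity provides in finite dimension, is good enough: the
  constant only replaces \<open>\<parallel>M\<parallel>\<close> by \<open>B \<parallel>M\<parallel>\<close> in the majorising exponential series.
\<close>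

lemma summable_mexp: "summable (\<lambda>k. (1 / fact k) *\<^sub>R mpow (M :: complex^'n^'n) k)"
proof -
  obtain B where B: "B > 0" "\<forall>(x :: complex^'n^'n) (y :: complex^'n^'n). norm (x ** y) \<le> B * norm x * norm y"
    using bilinear_bounded_pos[OF bilinear_matrix_mult] by blast
  define n1 where "n1 = norm (mat 1 :: complex^'n^'n)"
  have bound: "norm (mpow M k) \<le> (B * norm M) ^ k * n1" for k
  proof (induction k)
    case (Suc k)
    have "norm (mpow M (Suc k)) \<le> (B * norm M) * norm (mpow M k)" using B(2) by simp
    also have "\<dots> \<le> (B * norm M) * ((B * norm M) ^ k * n1)"
      using Suc B(1) by (intro mult_left_mono) auto
    finally show ?case by (simp add: mult.assoc)
  qed (simp add: n1_def)
  have "summable (\<lambda>k. n1 * ((B * norm M) ^ k /\<^sub>R fact k))"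
    by (intro summable_mult sums_summable[OF exp_converges])
  moreover have "norm ((1 / fact k) *\<^sub>R mpow M k) \<le> n1 * ((B * norm M) ^ k /\<^sub>R fact k)" for k
    using bound[of k] by (simp add: field_simps)
  ultimately show ?thesis
    by (rule summable_comparison_test'[where N = 0])
qed

text \<open>
  The way in which the exponential is used below: the entries of \<open>e\<^bsup>M\<^esup> v\<close> are scalar power series,
  to which the classical theorems apply.
\<close>

lemma mexp_apply_sums:
  fixes M :: "complex^'n^'n"
  shows "(\<lambda>k. (1 / fact k) * (mpow M k *v v) $ i) sums (mexp M *v v) $ i"
proof -
  have "bounded_linear (\<lambda>N :: complex^'n^'n. (N *v v) $ i)"
    using bilinear_matrix_vector_mult[where 'm = 'n and 'n = 'n] unfolding bilinear_def
    by (intro bounded_linear_compose[OF bounded_linear_vec_nth])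
       (simp add: linear_conv_bounded_linear)
  from bounded_linear.sums[OF this summable_sums[OF summable_mexp]]
  show ?thesis
    by (simp add: mexp_def mpow_def scaleR_matrix_apply scaleR_conv_of_real[where 'a = complex])
qed

lemma mexp_eigenvector:
  assumes "M *v v = \<mu> *s v"
  shows "mexp M *v v = exp \<mu> *s v"
proof (subst vec_eq_iff, intro allI)
  fix i
  have "(\<lambda>k. (1 / fact k) * (\<mu> ^ k *s v) $ i) sums (mexp M *v v) $ i"
    using mexp_apply_sums[of M v i] by (simp only: mpow_eigenvector[OF assms])
  moreover have "(\<lambda>k. (\<mu> ^ k /\<^sub>R fact k) * v $ i) sums (exp \<mu> * v $ i)"
    by (intro sums_mult2 exp_converges)
  moreover have "(\<lambda>k. (\<mu> ^ k /\<^sub>R fact k) * v $ i) = (\<lambda>k. (1 / fact k) * (\<mu> ^ k *s v) $ i)"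
    by (simp add: scaleR_conv_of_real field_simps)
  ultimately show "(mexp M *v v) $ i = (exp \<mu> *s v) $ i"
    by (simp add: sums_unique2)
qed

lemma mexp_0_apply: "mexp 0 *v v = (v :: complex^'n)"
  using mexp_eigenvector[of 0 v 0] by simp

text \<open>
  The differential equation \<open>y' = M y\<close> of the orbit \<open>y(t) = e\<^bsup>tM\<^esup> v\<close>, entry by entry, obtained by
  differentiating the power series in \<open>t\<close> term by term in the complex plane.
\<close>

lemma mexp_apply_has_vector_derivative:
  fixes M :: "complex^'n^'n"
  shows "((\<lambda>t. (mexp (t *\<^sub>R M) *v v) $ i) has_vector_derivative
            (M *v (mexp (t *\<^sub>R M) *v v)) $ i) (at t)"
proof -
  define c where "c j k = (1 / fact k) * (mpow M k *v v) $ j" for j k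
  have series: "(\<lambda>k. c j k * of_real s ^ k) sums (mexp (s *\<^sub>R M) *v v) $ j" for j s
    using mexp_apply_sums[of "s *\<^sub>R M" v j]
    by (simp add: c_def mpow_scaleR scaleR_matrix_apply mult_ac scaleR_conv_of_real[where 'a = complex])
  have deriv: "((\<lambda>z. \<Sum>k. c i k * z ^ k) has_field_derivative
                (\<Sum>k. diffs (c i) k * of_real t ^ k)) (at (of_real t))"
  proof (rule termdiffs_strong)
    show "summable (\<lambda>k. c i k * of_real (\<bar>t\<bar> + 1) ^ k)"
      using series by (rule sums_summable)
  qed simp
  have "diffs (c i) k = (\<Sum>j\<in>UNIV. M $ i $ j * c j k)" for k
  proof -
    have "diffs (c i) k = (1 / fact k) * (M *v (mpow M k *v v)) $ i"
      by (simp add: diffs_def c_def matrix_vector_mul_assoc divide_simps del: of_nat_Suc)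
    then show ?thesis
      by (simp add: c_def matrix_vector_mult_def sum_distrib_left mult_ac)
  qed
  then have "(\<lambda>k. diffs (c i) k * of_real t ^ k) =
             (\<lambda>k. \<Sum>j\<in>UNIV. M $ i $ j * (c j k * of_real t ^ k))"
    by (simp add: sum_distrib_left sum_distrib_right mult_ac)
  also have "\<dots> sums (\<Sum>j\<in>UNIV. M $ i $ j * (mexp (t *\<^sub>R M) *v v) $ j)"
    by (intro sums_sum sums_mult series)
  finally have "(\<Sum>k. diffs (c i) k * of_real t ^ k) = (M *v (mexp (t *\<^sub>R M) *v v)) $ i"
    by (simp add: sums_iff matrix_vector_mult_def)
  with deriv have "((\<lambda>z. \<Sum>k. c i k * z ^ k) has_field_derivative
                (M *v (mexp (t *\<^sub>R M) *v v)) $ i) (at (of_real t))" by simp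
  from has_vector_derivative_real_field[OF this]
  show ?thesis using series by (simp add: sums_iff)
qed

section \<open>Decay of two coupled damped modes\<close>

definition coupling_matrix :: "real \<Rightarrow> real \<Rightarrow> real \<Rightarrow> complex^2^2" where
  "coupling_matrix p q \<tau> = vector
     [vector [of_real p, \<i> * of_real \<tau>],
      vector [\<i> * of_real \<tau>, of_real q]]"

lemma coupling_matrix_apply:
  "(coupling_matrix p q \<tau> *v y) $ 1 = of_real p * y $ 1 + \<i> * of_real \<tau> * y $ 2"
  "(coupling_matrix p q \<tau> *v y) $ 2 = \<i> * of_real \<tau> * y $ 1 + of_real q * y $ 2"
  by (simp_all add: coupling_matrix_def matrix_vector_mult_def sum_2)

lemma norm_sq_complex2: "(norm (y :: complex^2))\<^sup>2 = (cmod (y $ 1))\<^sup>2 + (cmod (y $ 2))\<^sup>2"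
  by (simp add: norm_vec_def L2_set_def sum_2)

lemma exp_decay_of_deriv_le:
  fixes \<Phi> :: "real \<Rightarrow> real"
  assumes deriv: "\<And>s. (\<Phi> has_real_derivative \<Phi>' s) (at s)"
    and le: "\<And>s. \<Phi>' s \<le> - \<kappa> * \<Phi> s"
    and t: "0 \<le> t"
  shows "\<Phi> t \<le> exp (- \<kappa> * t) * \<Phi> 0"
proof -
  have "\<Phi> t * exp (\<kappa> * t) \<le> \<Phi> 0 * exp (\<kappa> * 0)"
  proof (rule DERIV_nonpos_imp_nonincreasing[OF t], intro exI conjI)
    fix s
    show "((\<lambda>s. \<Phi> s * exp (\<kappa> * s)) has_real_derivative (\<Phi>' s + \<kappa> * \<Phi> s) * exp (\<kappa> * s)) (at s)"
      by (auto intro!: derivative_eq_intros deriv simp: algebra_simps)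
    show "(\<Phi>' s + \<kappa> * \<Phi> s) * exp (\<kappa> * s) \<le> 0"
      using le[of s] by (simp add: mult_nonpos_nonneg)
  qed
  then show ?thesis by (simp add: exp_minus field_simps)
qed

text \<open>
  Along \<open>Y' = - M Y\<close> with \<open>M = coupling_matrix p q \<tau>\<close>, put \<open>x = \<bar>Y\<^sub>1\<bar>\<^sup>2\<close>, \<open>y = \<bar>Y\<^sub>2\<bar>\<^sup>2\<close> and
  \<open>j = Im(Y\<^sub>2 cnj Y\<^sub>1)\<close>. Then \<open>x' = - 2 p x + 2 \<tau> j\<close>, \<open>y' = - 2 q y - 2 \<tau> j\<close> and
  \<open>j' = - \<tau> x + \<tau> y - (p + q) j\<close>. The right-hand side of the assumption on \<open>x\<close>, \<open>y\<close>, \<open>j\<close> is therefore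
  minus the derivative of \<open>\<Phi> = x + y + 2 \<gamma> j\<close>, and the assumption says \<open>\<Phi>' \<le> - \<kappa> \<Phi>\<close>. It is
  required only for \<open>j\<^sup>2 \<le> x y\<close>, which is Cauchy--Schwarz and also makes \<open>\<Phi>\<close> equivalent to \<open>x + y\<close>.
\<close>

lemma lyapunov_decay:
  fixes v :: "complex^2"
  assumes \<gamma>: "\<bar>\<gamma>\<bar> < 1"
    and diss: "\<And>x y j. 0 \<le> x \<Longrightarrow> 0 \<le> y \<Longrightarrow> j\<^sup>2 \<le> x * y \<Longrightarrow>
       \<kappa> * (x + y + 2 * \<gamma> * j) \<le> 2 * (p + \<gamma> * \<tau>) * x + 2 * (q - \<gamma> * \<tau>) * y + 2 * \<gamma> * (p + q) * j"
    and t: "0 \<le> t"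
  shows "(1 - \<bar>\<gamma>\<bar>) * (norm (mexp (- (t *\<^sub>R coupling_matrix p q \<tau>)) *v v))\<^sup>2
           \<le> (1 + \<bar>\<gamma>\<bar>) * exp (- \<kappa> * t) * (norm v)\<^sup>2"
proof -
  define Y where "Y s = mexp (s *\<^sub>R (- coupling_matrix p q \<tau>)) *v v" for s
  define x\<^sub>1 y\<^sub>1 x\<^sub>2 y\<^sub>2 where "x\<^sub>1 s = Re (Y s $ 1)" and "y\<^sub>1 s = Im (Y s $ 1)"
    and "x\<^sub>2 s = Re (Y s $ 2)" and "y\<^sub>2 s = Im (Y s $ 2)" for s
  note coords = x\<^sub>1_def y\<^sub>1_def x\<^sub>2_def y\<^sub>2_def
  define N where "N s = (x\<^sub>1 s)\<^sup>2 + (y\<^sub>1 s)\<^sup>2 + ((x\<^sub>2 s)\<^sup>2 + (y\<^sub>2 s)\<^sup>2)" for s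
  define J where "J s = x\<^sub>1 s * y\<^sub>2 s - y\<^sub>1 s * x\<^sub>2 s" for s
  define \<Phi> where "\<Phi> s = N s + 2 * \<gamma> * J s" for s
  have norm_Y: "(norm (Y s))\<^sup>2 = N s" for s
    by (simp add: norm_sq_complex2 N_def coords cmod_power2)
  have vec: "((\<lambda>s. Y s $ i) has_vector_derivative - (coupling_matrix p q \<tau> *v Y s) $ i) (at s)" for i s
    using mexp_apply_has_vector_derivative[where M = "- coupling_matrix p q \<tau>" and v = v]
    unfolding Y_def by (simp add: matrix_vector_mult_def sum_negf)
  have [derivative_intros]:
    "(x\<^sub>1 has_real_derivative - p * x\<^sub>1 s + \<tau> * y\<^sub>2 s) (at s)"
    "(y\<^sub>1 has_real_derivative - p * y\<^sub>1 s - \<tau> * x\<^sub>2 s) (at s)"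
    "(x\<^sub>2 has_real_derivative - q * x\<^sub>2 s + \<tau> * y\<^sub>1 s) (at s)"
    "(y\<^sub>2 has_real_derivative - \<tau> * x\<^sub>1 s - q * y\<^sub>2 s) (at s)" for s
    using bounded_linear.has_vector_derivative[OF bounded_linear_Re vec[of 1 s]]
      bounded_linear.has_vector_derivative[OF bounded_linear_Im vec[of 1 s]]
      bounded_linear.has_vector_derivative[OF bounded_linear_Re vec[of 2 s]]
      bounded_linear.has_vector_derivative[OF bounded_linear_Im vec[of 2 s]]
    by (simp_all add: has_real_derivative_iff_has_vector_derivative coords[abs_def] coupling_matrix_apply
        algebra_simps)
  define X Z where "X s = (x\<^sub>1 s)\<^sup>2 + (y\<^sub>1 s)\<^sup>2" and "Z s = (x\<^sub>2 s)\<^sup>2 + (y\<^sub>2 s)\<^sup>2" for s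
  define \<Phi>' where "\<Phi>' s = - (2 * (p + \<gamma> * \<tau>) * X s + 2 * (q - \<gamma> * \<tau>) * Z s + 2 * \<gamma> * (p + q) * J s)" for s
  have "(\<Phi> has_real_derivative \<Phi>' s) (at s)" for s
    unfolding \<Phi>_def[abs_def] N_def J_def
    by (rule derivative_eq_intros refl)+
       (simp add: \<Phi>'_def X_def Z_def J_def power2_eq_square algebra_simps)
  moreover have J2: "(J s)\<^sup>2 \<le> X s * Z s" for s
  proof -
    have "X s * Z s - (J s)\<^sup>2 = (x\<^sub>1 s * x\<^sub>2 s + y\<^sub>1 s * y\<^sub>2 s)\<^sup>2"
      by (simp add: X_def Z_def J_def power2_eq_square algebra_simps)
    then show ?thesis by (metis diff_ge_0_iff_ge zero_le_power2)
  qed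
  moreover have "\<Phi>' s \<le> - \<kappa> * \<Phi> s" for s
    using diss[OF _ _ J2, of s] by (simp add: \<Phi>'_def \<Phi>_def N_def X_def Z_def)
  ultimately have decay: "\<Phi> t \<le> exp (- \<kappa> * t) * \<Phi> 0"
    using t by (intro exp_decay_of_deriv_le)
  have bound: "\<bar>2 * \<gamma> * J s\<bar> \<le> \<bar>\<gamma>\<bar> * N s" for s
  proof -
    have "4 * (X s * Z s) \<le> (N s)\<^sup>2"
      using zero_le_power2[of "X s - Z s"]
      by (simp add: N_def X_def Z_def power2_eq_square algebra_simps)
    then have "(2 * J s)\<^sup>2 \<le> (N s)\<^sup>2" using J2[of s] by (simp add: power_mult_distrib)
    then have "\<bar>2 * J s\<bar> \<le> N s" by (rule abs_le_square_iff[THEN iffD2, THEN order_trans])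
        (simp add: N_def)
    from mult_left_mono[OF this, of "\<bar>\<gamma>\<bar>"] show ?thesis by (simp add: abs_mult mult_ac)
  qed
  have "(1 - \<bar>\<gamma>\<bar>) * N s \<le> \<Phi> s" "\<Phi> s \<le> (1 + \<bar>\<gamma>\<bar>) * N s" for s
    using bound[of s] unfolding \<Phi>_def left_diff_distrib distrib_right by linarith+
  with decay have "(1 - \<bar>\<gamma>\<bar>) * N t \<le> exp (- \<kappa> * t) * ((1 + \<bar>\<gamma>\<bar>) * N 0)"
    by (meson exp_ge_zero mult_left_mono order_trans)
  moreover have "N 0 = (norm v)\<^sup>2"
    using norm_Y[of 0] by (simp add: Y_def mexp_0_apply)
  ultimately show ?thesis
    using norm_Y[of t] by (simp add: Y_def mult_ac)
qed

lemma opnorm_lyapunov: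
  assumes \<gamma>: "\<bar>\<gamma>\<bar> < 1"
    and diss: "\<And>x y j. 0 \<le> x \<Longrightarrow> 0 \<le> y \<Longrightarrow> j\<^sup>2 \<le> x * y \<Longrightarrow>
       \<kappa> * (x + y + 2 * \<gamma> * j) \<le> 2 * (p + \<gamma> * \<tau>) * x + 2 * (q - \<gamma> * \<tau>) * y + 2 * \<gamma> * (p + q) * j"
    and t: "0 \<le> t"
  shows "opnorm (mexp (- (t *\<^sub>R coupling_matrix p q \<tau>)))
           \<le> sqrt ((1 + \<bar>\<gamma>\<bar>) / (1 - \<bar>\<gamma>\<bar>)) * exp (- \<kappa> * t / 2)"
  unfolding opnorm_def
proof (rule onorm_le)
  fix v :: "complex^2"
  let ?w = "mexp (- (t *\<^sub>R coupling_matrix p q \<tau>)) *v v"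
  have "(norm ?w)\<^sup>2 \<le> (1 + \<bar>\<gamma>\<bar>) / (1 - \<bar>\<gamma>\<bar>) * exp (- \<kappa> * t) * (norm v)\<^sup>2"
    using lyapunov_decay[OF assms, of v] \<gamma> by (simp add: field_simps)
  also have "\<dots> = (sqrt ((1 + \<bar>\<gamma>\<bar>) / (1 - \<bar>\<gamma>\<bar>)) * exp (- \<kappa> * t / 2) * norm v)\<^sup>2"
    using \<gamma> by (simp add: power_mult_distrib exp_double[symmetric] real_sqrt_pow2)
  finally show "norm ?w \<le> sqrt ((1 + \<bar>\<gamma>\<bar>) / (1 - \<bar>\<gamma>\<bar>)) * exp (- \<kappa> * t / 2) * norm v"
    by (rule power2_le_imp_le) (use \<gamma> in simp)
qed

text \<open>
  The case \<open>\<gamma> = 0\<close>: the coupling drops out of the derivative of \<open>\<bar>Y\<bar>\<^sup>2\<close>, and the constant is \<open>1\<close>.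
\<close>

lemma opnorm_contraction:
  assumes "m \<le> p" "m \<le> q" "0 \<le> t"
  shows "opnorm (mexp (- (t *\<^sub>R coupling_matrix p q \<tau>))) \<le> exp (- m * t)"
proof -
  have "2 * m * (x + y) \<le> 2 * p * x + 2 * q * y" if "0 \<le> x" "0 \<le> y" for x y
    using mult_right_mono[OF assms(1) that(1)] mult_right_mono[OF assms(2) that(2)]
    by (simp add: algebra_simps)
  with opnorm_lyapunov[of 0 "2 * m" p \<tau> q t] assms(3) show ?thesis by simp
qed

lemma norm_mexp_apply_le: "norm (mexp M *v v) \<le> opnorm (mexp M) * norm v"
  unfolding opnorm_def by (rule onorm[OF bounded_linear_matrix_vector_mult])

text \<open>
  On an eigenvector the semigroup is multiplication by \<open>e\<^bsup>- t \<mu>\<^esup>\<close>, and a bound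
  \<open>e\<^bsup>(\<kappa> - Re \<mu>) t\<^esup> \<le> C\<close> for all \<open>t > 0\<close> forces \<open>\<kappa> \<le> Re \<mu>\<close>.
\<close>

lemma Re_eigenvalue_ge_decay_rate:
  fixes M :: "complex^'n^'n"
  assumes eig: "M *v v = \<mu> *s v" and v: "v \<noteq> 0"
    and decay: "\<And>t. t > 0 \<Longrightarrow> opnorm (mexp (- (t *\<^sub>R M))) \<le> C * exp (- \<kappa> * t)"
  shows "\<kappa> \<le> Re \<mu>"
proof (rule ccontr)
  assume "\<not> \<kappa> \<le> Re \<mu>"
  then have pos: "\<kappa> - Re \<mu> > 0" by simp
  have growth: "exp ((\<kappa> - Re \<mu>) * t) \<le> C" if "t > 0" for t
  proof -
    have "- (t *\<^sub>R M) *v v = (- of_real t * \<mu>) *s v"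
      using eig by (simp add: vec_eq_iff matrix_vector_mult_def sum_negf mult.assoc
          scaleR_conv_of_real[where 'a = complex] flip: sum_distrib_left)
    then have "norm (mexp (- (t *\<^sub>R M)) *v v) = norm (exp (- of_real t * \<mu>) *s v)"
      by (simp only: mexp_eigenvector)
    also have "\<dots> = exp (- t * Re \<mu>) * norm v"
      by (simp add: norm_vec_def L2_set_def norm_mult power_mult_distrib flip: sum_distrib_left)
         (simp add: real_sqrt_mult)
    finally have "exp (- t * Re \<mu>) * norm v \<le> opnorm (mexp (- (t *\<^sub>R M))) * norm v"
      using norm_mexp_apply_le by metis
    then have "exp (- t * Re \<mu>) \<le> C * exp (- \<kappa> * t)"
      using v decay[OF that] by simp
    then have "exp (- t * Re \<mu>) * exp (\<kappa> * t) \<le> C * exp (- \<kappa> * t) * exp (\<kappa> * t)"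
      by (intro mult_right_mono) auto
    then show ?thesis by (simp add: mult.assoc algebra_simps flip: exp_add)
  qed
  have "C > 0" using growth[of 1] by (smt (verit) exp_gt_zero)
  \<comment> \<open>At this time the lower bound is \<open>e\<^bsup>C\<^esup>\<close>, which exceeds \<open>C\<close>.\<close>
  then have "exp C \<le> C" using growth[of "C / (\<kappa> - Re \<mu>)"] pos by simp
  then show False using exp_ge_add_one_self[of C] by simp
qed

text \<open>
  The hypothesis is the characteristic equation. A nonzero column of the adjugate of \<open>M - \<mu>\<close> is an
  eigenvector; if there is none, \<open>M\<close> is the multiple \<open>\<mu>\<close> of the identity.
\<close>

lemma eigenvector_2x2:
  fixes M :: "complex^2^2"
  assumes "(M $ 1 $ 1 - \<mu>) * (M $ 2 $ 2 - \<mu>) = M $ 1 $ 2 * M $ 2 $ 1"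
  shows "\<exists>v. v \<noteq> 0 \<and> M *v v = \<mu> *s v"
proof -
  have "\<exists>x y. (x \<noteq> 0 \<or> y \<noteq> 0) \<and> M $ 1 $ 1 * x + M $ 1 $ 2 * y = \<mu> * x
                          \<and> M $ 2 $ 1 * x + M $ 2 $ 2 * y = \<mu> * y"
  proof (cases "M $ 1 $ 2 = 0 \<and> \<mu> = M $ 1 $ 1")
    case False
    then show ?thesis
      using assms by (intro exI[of _ "M $ 1 $ 2"] exI[of _ "\<mu> - M $ 1 $ 1"]) (auto simp: algebra_simps)
  next
    case top: True
    show ?thesis
    proof (cases "M $ 2 $ 1 = 0 \<and> \<mu> = M $ 2 $ 2")
      case False
      with top show ?thesis
        by (intro exI[of _ "\<mu> - M $ 2 $ 2"] exI[of _ "M $ 2 $ 1"]) (auto simp: algebra_simps)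
    next
      case True
      with top show ?thesis by (intro exI[of _ 1] exI[of _ 0]) auto
    qed
  qed
  then obtain x y where "x \<noteq> 0 \<or> y \<noteq> 0" "M $ 1 $ 1 * x + M $ 1 $ 2 * y = \<mu> * x"
    "M $ 2 $ 1 * x + M $ 2 $ 2 * y = \<mu> * y" by blast
  then show ?thesis
    by (intro exI[of _ "vector [x, y]"])
       (auto simp: vec_eq_iff forall_2 matrix_vector_mult_def sum_2)
qed

text \<open>
  An obstruction to fast decay that avoids computing eigenvalues: their product is the determinant,
  and each has real part, hence modulus, at least the decay rate.
\<close>

lemma decay_rate_sq_le_norm_det:
  fixes M :: "complex^2^2"
  assumes decay: "\<And>t. t > 0 \<Longrightarrow> opnorm (mexp (- (t *\<^sub>R M))) \<le> C * exp (- \<kappa> * t)"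
    and \<kappa>: "0 \<le> \<kappa>"
  shows "\<kappa>\<^sup>2 \<le> cmod (det M)"
proof -
  define tr where "tr = M $ 1 $ 1 + M $ 2 $ 2"
  define r where "r = csqrt (tr\<^sup>2 - 4 * det M)"
  have r2: "r * r = tr\<^sup>2 - 4 * det M"
    by (simp add: r_def flip: power2_eq_square)
  define \<mu>\<^sub>1 \<mu>\<^sub>2 where "\<mu>\<^sub>1 = (tr + r) / 2" and "\<mu>\<^sub>2 = (tr - r) / 2"
  have prod: "\<mu>\<^sub>1 * \<mu>\<^sub>2 = det M"
    using r2 by (simp add: \<mu>\<^sub>1_def \<mu>\<^sub>2_def field_simps power2_eq_square)
  have sum: "\<mu>\<^sub>1 + \<mu>\<^sub>2 = tr" by (simp add: \<mu>\<^sub>1_def \<mu>\<^sub>2_def field_simps)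
  have Re_ge: "\<kappa> \<le> Re \<mu>" if "\<mu> = \<mu>\<^sub>1 \<or> \<mu> = \<mu>\<^sub>2" for \<mu>
  proof -
    have "\<mu> * \<mu> - tr * \<mu> + det M = 0"
      using that unfolding prod[symmetric] sum[symmetric] by (auto simp: algebra_simps)
    then have "(M $ 1 $ 1 - \<mu>) * (M $ 2 $ 2 - \<mu>) = M $ 1 $ 2 * M $ 2 $ 1"
      by (simp add: tr_def det_2 algebra_simps)
    then obtain v where "v \<noteq> 0" "M *v v = \<mu> *s v" using eigenvector_2x2 by blast
    then show ?thesis using Re_eigenvalue_ge_decay_rate decay by blast
  qed
  have "\<kappa> * \<kappa> \<le> cmod \<mu>\<^sub>1 * cmod \<mu>\<^sub>2"
    using Re_ge[of \<mu>\<^sub>1] Re_ge[of \<mu>\<^sub>2] complex_Re_le_cmod[of \<mu>\<^sub>1] complex_Re_le_cmod[of \<mu>\<^sub>2] \<kappa>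
    by (intro mult_mono) auto
  then show ?thesis by (simp add: power2_eq_square norm_mult flip: prod)
qed

section \<open>Transfer of damping through the coupling\<close>

text \<open>
  The differential inequality for the Lyapunov functional when the damping is \<open>r\<close> in the second
  component and possibly as small as \<open>p = 0\<close> in the first one. For a coupling \<open>T\<close> of the size of \<open>r\<close>,
  the mixed term of the functional produces the damping \<open>2 g T x \<ge> 2 g k r x\<close>. Its price, the loss
  \<open>2 g T y\<close> and the term in \<open>j\<close>, is paid by the damping of \<open>y\<close> and half of the one gained for \<open>x\<close>,
  if \<open>g\<close> is small as assumed.
\<close>

lemma lyapunov_dissipation:
  fixes p r T k K g \<gamma> x y j :: real
  assumes k: "0 < k" and g: "0 < g" "g \<le> 1 / 2" "2 * g * K + 4 * g / k \<le> 1"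
    and p: "0 \<le> p" "p \<le> r" and r: "0 < r" and T: "k * r \<le> T" "T \<le> K * r" and \<gamma>: "\<bar>\<gamma>\<bar> = g"
    and xy: "0 \<le> x" "0 \<le> y" "j\<^sup>2 \<le> x * y"
  shows "2 / 3 * (g * k) * r * (x + y + 2 * \<gamma> * j)
           \<le> 2 * (p + g * T) * x + 2 * (r - g * T) * y + 2 * \<gamma> * (p + r) * j"
proof -
  have j_le: "\<bar>2 * s * j\<bar> \<le> s * (c * x + y / c)" if "0 < c" "0 \<le> s" for c s
  proof -
    have "(2 * j)\<^sup>2 \<le> 4 * (x * y)" using xy(3) by simp
    also have "\<dots> \<le> (c * x + y / c)\<^sup>2"
      using zero_le_power2[of "c * x - y / c"] that(1)
      by (simp add: power2_eq_square algebra_simps)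
    finally have "\<bar>2 * j\<bar> \<le> \<bar>c * x + y / c\<bar>" by (simp add: abs_le_square_iff)
    then have "\<bar>2 * j\<bar> \<le> c * x + y / c" using xy that by simp
    from mult_left_mono[OF this that(2)] show ?thesis using that(2) by (simp add: abs_mult mult_ac)
  qed
  have abs_\<gamma>: "\<bar>2 * \<gamma> * u\<bar> = \<bar>2 * g * u\<bar>" for u using \<gamma> g by (simp add: abs_mult)
  have gk: "0 < g * k" using k g by simp
  \<comment> \<open>The functional is at most \<open>3/2\<close> times \<open>x + y\<close>.\<close>
  have "\<bar>2 * \<gamma> * j\<bar> \<le> 1 / 2 * (x + y)"
    using j_le[of 1 g] g(1) xy mult_right_mono[OF g(2), of "x + y"] unfolding abs_\<gamma> by simp
  then have "2 / 3 * (x + y + 2 * \<gamma> * j) \<le> x + y" by (simp add: abs_le_iff)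
  then have "g * k * r * (2 / 3 * (x + y + 2 * \<gamma> * j)) \<le> g * k * r * (x + y)"
    using gk r by (intro mult_left_mono) auto
  also have "\<dots> \<le> 2 * (p + g * T) * x + 2 * (r - g * T) * y + 2 * \<gamma> * (p + r) * j"
  proof -
    have "k \<le> K" using T r by (metis mult_le_cancel_right_pos order_trans)
    then have "2 * (g * k) \<le> 2 * (g * K)" using g(1) by simp
    moreover have "4 * g / k \<ge> 0" using k g by simp
    ultimately have gk1: "g * k \<le> 1" using g(3) by simp
    \<comment> \<open>The weight \<open>k/2\<close> splits the mixed term so that its part in \<open>x\<close> is exactly half of the gain.\<close>
    have "\<bar>2 * \<gamma> * ((p + r) * j)\<bar> = \<bar>2 * (g * (p + r)) * j\<bar>"
      unfolding abs_\<gamma> by (simp only: mult.assoc)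
    also have "\<dots> \<le> g * (p + r) * (k / 2 * x + y / (k / 2))"
      using k g p by (intro j_le) auto
    also have "\<dots> \<le> g * (2 * r) * (k / 2 * x + y / (k / 2))"
      using k g p xy by (intro mult_right_mono mult_left_mono) auto
    also have "\<dots> = g * k * r * x + 4 * g / k * r * y"
      using k by (simp add: field_simps)
    finally have cross: "- (g * k * r * x + 4 * g / k * r * y) \<le> 2 * \<gamma> * (p + r) * j"
      by (simp add: abs_le_iff mult.assoc)
    have "g * (k * r) * x \<le> g * T * x"
      using T(1) g(1) xy(1) by (intro mult_right_mono mult_left_mono) auto
    moreover have "0 \<le> p * x" using p xy by simp
    ultimately have x_term: "2 * (g * k * r) * x \<le> 2 * (p + g * T) * x"
      by (simp add: algebra_simps)
    have "g * T * y \<le> g * (K * r) * y"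
      using T(2) g(1) xy(2) by (intro mult_right_mono mult_left_mono) auto
    then have y_term: "2 * (r - g * K * r) * y \<le> 2 * (r - g * T) * y"
      by (simp add: algebra_simps)
    have "(2 * g * K + 4 * g / k + g * k) * (r * y) \<le> (1 + 1) * (r * y)"
      using g(3) gk1 r xy by (intro mult_right_mono add_mono) auto
    then have "g * k * r * y \<le> 2 * (r - g * K * r) * y - 4 * g / k * r * y"
      by (simp add: algebra_simps)
    with x_term y_term cross show ?thesis by (simp add: distrib_left)
  qed
  finally show ?thesis by (simp add: mult_ac)
qed

text \<open>
  One damped component suffices if the coupling is comparable to the damping. With
  \<open>\<gamma> = g sgn \<tau>\<close> the functional transfers damping from the second to the first component, with the
  opposite sign in the other direction; the value of \<open>g\<close> is one that meets the smallness conditions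
  above, and the constant \<open>2\<close> bounds \<open>sqrt((1 + g) / (1 - g))\<close> for \<open>g \<le> 1/2\<close>.
\<close>

lemma opnorm_parabolic_decay:
  assumes k: "0 < k" and K: "0 < K" and g: "g = 1 / (2 + 2 * K + 4 / k)"
    and pq: "0 \<le> p" "p \<le> r" "0 \<le> q" "q \<le> r" "p = r \<or> q = r" and r: "0 < r"
    and \<tau>: "k * r \<le> \<bar>\<tau>\<bar>" "\<bar>\<tau>\<bar> \<le> K * r" and t: "0 \<le> t"
  shows "opnorm (mexp (- (t *\<^sub>R coupling_matrix p q \<tau>))) \<le> 2 * exp (- (g * k / 3) * r * t)"
proof -
  have den: "2 + 2 * K + 4 / k > 0" using k K by (simp add: add_pos_pos)
  have g_pos: "0 < g" using den by (simp add: g)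
  have "2 \<le> 2 + 2 * K + 4 / k" using k K by simp
  then have g_half: "g \<le> 1 / 2" unfolding g by (intro divide_left_mono) (use den in auto)
  have "2 * g * K + 4 * g / k = (2 * K + 4 / k) / (2 + 2 * K + 4 / k)"
    by (simp add: g add_divide_distrib)
  then have g_small: "2 * g * K + 4 * g / k \<le> 1" using den by simp
  have \<tau>_nz: "\<tau> \<noteq> 0" using mult_pos_pos[OF k r] \<tau>(1) by auto
  have "\<exists>\<gamma>. \<bar>\<gamma>\<bar> = g \<and> (\<forall>x y j. 0 \<le> x \<longrightarrow> 0 \<le> y \<longrightarrow> j\<^sup>2 \<le> x * y \<longrightarrow>
       2 / 3 * (g * k) * r * (x + y + 2 * \<gamma> * j)
         \<le> 2 * (p + \<gamma> * \<tau>) * x + 2 * (q - \<gamma> * \<tau>) * y + 2 * \<gamma> * (p + q) * j)"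
    using pq(5)
  proof
    assume q: "q = r"
    have eq: "sgn \<tau> * g * \<tau> = g * \<bar>\<tau>\<bar>" by (simp add: abs_sgn mult_ac)
    have "\<bar>sgn \<tau> * g\<bar> = g" using \<tau>_nz g_pos by (simp add: abs_mult abs_sgn_eq)
    with lyapunov_dissipation[OF k g_pos g_half g_small pq(1,2) r \<tau>, of "sgn \<tau> * g"]
    show ?thesis unfolding q by (intro exI[of _ "sgn \<tau> * g"]) (simp only: eq, simp)
  next
    assume p: "p = r"
    have eq: "- sgn \<tau> * g * \<tau> = - (g * \<bar>\<tau>\<bar>)" by (simp add: abs_sgn mult_ac)
    have "\<bar>- sgn \<tau> * g\<bar> = g" using \<tau>_nz g_pos by (simp add: abs_mult abs_sgn_eq)
    \<comment> \<open>The same inequality with the two components exchanged and the sign of \<open>\<gamma>\<close> reversed.\<close>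
    note swapped = lyapunov_dissipation[OF k g_pos g_half g_small pq(3,4) r \<tau> this]
    have "2 / 3 * (g * k) * r * (x + y + 2 * (- sgn \<tau> * g) * j)
         \<le> 2 * (r + - sgn \<tau> * g * \<tau>) * x + 2 * (q - - sgn \<tau> * g * \<tau>) * y + 2 * (- sgn \<tau> * g) * (r + q) * j"
      if "0 \<le> x" "0 \<le> y" "j\<^sup>2 \<le> x * y" for x y j
      using swapped[of y x j] that unfolding eq by (simp add: add_ac mult.commute[of x y])
    with \<open>\<bar>- sgn \<tau> * g\<bar> = g\<close> show ?thesis unfolding p by blast
  qed
  then obtain \<gamma> where \<gamma>: "\<bar>\<gamma>\<bar> = g" and diss: "\<And>x y j. 0 \<le> x \<Longrightarrow> 0 \<le> y \<Longrightarrow> j\<^sup>2 \<le> x * y \<Longrightarrow>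
       2 / 3 * (g * k) * r * (x + y + 2 * \<gamma> * j)
         \<le> 2 * (p + \<gamma> * \<tau>) * x + 2 * (q - \<gamma> * \<tau>) * y + 2 * \<gamma> * (p + q) * j" by blast
  have "opnorm (mexp (- (t *\<^sub>R coupling_matrix p q \<tau>)))
      \<le> sqrt ((1 + g) / (1 - g)) * exp (- (2 / 3 * (g * k) * r) * t / 2)"
    using opnorm_lyapunov[of \<gamma>, OF _ diss t] g_half by (simp add: \<gamma>)
  also have "- (2 / 3 * (g * k) * r) * t / 2 = - (g * k / 3) * r * t" by simp
  also have "sqrt ((1 + g) / (1 - g)) \<le> 2"
    using g_half g_pos by (intro real_le_lsqrt) (simp_all add: field_simps)
  finally show ?thesis by (simp add: mult_right_mono)
qed

section \<open>The Plancherel inequality for integrable functions\<close>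

lemma integrable_lborel_product:
  fixes f g :: "real \<Rightarrow> real"
  assumes "integrable lborel f" "integrable lborel g"
  shows "integrable (lborel \<Otimes>\<^sub>M lborel) (\<lambda>(x, y). f x * g y)"
proof (rule lborel_pair.Fubini_integrable)
  note [measurable] = borel_measurable_integrable[OF assms(1)] borel_measurable_integrable[OF assms(2)]
  show "(\<lambda>(x, y). f x * g y) \<in> borel_measurable (lborel \<Otimes>\<^sub>M lborel)" by measurable
  show "integrable lborel (\<lambda>x. \<integral>y. norm (case (x, y) of (x, y) \<Rightarrow> f x * g y) \<partial>lborel)"
    using assms by (simp add: abs_mult)
  show "AE x in lborel. integrable lborel (\<lambda>y. case (x, y) of (x, y) \<Rightarrow> f x * g y)"
    using assms by simp
qed

text \<open>
  Valid without integrability, since the Bochner integral then takes the default value \<open>0\<close>.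
\<close>

lemma norm_integral_le_nn_integral:
  fixes f :: "'a \<Rightarrow> 'b :: {banach, second_countable_topology}"
  shows "ennreal (norm (\<integral>x. f x \<partial>M)) \<le> (\<integral>\<^sup>+x. ennreal (norm (f x)) \<partial>M)"
  by (cases "integrable M f") (auto intro: integral_norm_bound_ennreal simp: not_integrable_integral_eq)

lemma gaussian_scaled_integrable:
  assumes "s > (0::real)"
  shows "integrable lborel (\<lambda>\<xi>. exp (- (s * \<xi>)\<^sup>2 / 2))"
proof -
  have "integrable lborel (\<lambda>\<xi>. sqrt (2 * pi) * std_normal_density (0 + s * \<xi>))"
    using assms by (intro integrable_mult_right lborel_integrable_real_affine) auto
  then show ?thesis by (simp add: std_normal_density_def)
qed

text \<open>
  The characteristic function of the standard normal distribution after the substitution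
  \<open>x = s \<xi>\<close>. The result is written as a multiple of a density so that its total mass is at hand.
\<close>

lemma fourier_gaussian:
  assumes s: "s > 0"
  shows "(\<integral>\<xi>. exp (\<i> * of_real (u * \<xi>)) * of_real (exp (- (s * \<xi>)\<^sup>2 / 2)) \<partial>lborel)
           = complex_of_real (2 * pi * normal_density 0 s u)"
proof -
  have "complex_of_real (exp (- (u / s)\<^sup>2 / 2)) = char std_normal_distribution (u / s)"
    by (simp add: char_std_normal_distribution)
  also have "\<dots> = (\<integral>x. std_normal_density x *\<^sub>R exp (\<i> * of_real (u / s * x)) \<partial>lborel)"
    unfolding char_def by (subst integral_density) (auto simp: normal_density_nonneg)
  also have "\<dots> = s *\<^sub>R (\<integral>\<xi>. std_normal_density (s * \<xi>) *\<^sub>R exp (\<i> * of_real (u * \<xi>)) \<partial>lborel)"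
    using s by (subst lborel_integral_real_affine[where c = s and t = 0]) auto
  also have "(\<integral>\<xi>. std_normal_density (s * \<xi>) *\<^sub>R exp (\<i> * of_real (u * \<xi>)) \<partial>lborel) =
     (\<integral>\<xi>. of_real (1 / sqrt (2 * pi)) *
         (exp (\<i> * of_real (u * \<xi>)) * of_real (exp (- (s * \<xi>)\<^sup>2 / 2))) \<partial>lborel)"
    by (intro Bochner_Integration.integral_cong)
       (auto simp: std_normal_density_def scaleR_conv_of_real exp_of_real)
  finally have "complex_of_real (exp (- (u / s)\<^sup>2 / 2)) = of_real (s / sqrt (2 * pi)) *
      (\<integral>\<xi>. exp (\<i> * of_real (u * \<xi>)) * of_real (exp (- (s * \<xi>)\<^sup>2 / 2)) \<partial>lborel)" (is "_ = _ * ?I")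
    by (simp add: scaleR_conv_of_real)
  then have "?I = of_real (exp (- (u / s)\<^sup>2 / 2) * (sqrt (2 * pi) / s))"
    using s by (simp add: field_simps)
  also have "exp (- (u / s)\<^sup>2 / 2) * (sqrt (2 * pi) / s) = 2 * pi * normal_density 0 s u"
    using s by (simp add: normal_density_def real_sqrt_mult power_divide real_div_sqrt field_simps)
  finally show ?thesis .
qed

lemma nn_integral_normal_density_shift:
  assumes "s > 0"
  shows "(\<integral>\<^sup>+y. ennreal (normal_density 0 s (y - x)) \<partial>lborel) = 1"
    and "(\<integral>\<^sup>+y. ennreal (normal_density 0 s (x - y)) \<partial>lborel) = 1"
proof -
  have 1: "(\<integral>\<^sup>+y. ennreal (normal_density \<mu> s y) \<partial>lborel) = 1" for \<mu>
    using assms by (subst nn_integral_eq_integral) auto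
  have "normal_density 0 s (y - x) = normal_density x s y" for y
    by (simp add: normal_density_def)
  with 1 show "(\<integral>\<^sup>+y. ennreal (normal_density 0 s (y - x)) \<partial>lborel) = 1" by simp
  have "normal_density 0 s (x - y) = normal_density x s y" for y
    by (simp add: normal_density_def power2_commute)
  with 1 show "(\<integral>\<^sup>+y. ennreal (normal_density 0 s (x - y)) \<partial>lborel) = 1" by simp
qed

lemma measurable_cnj [measurable]: "cnj \<in> borel_measurable borel"
  by (intro borel_measurable_continuous_onI continuous_intros)

definition fourier_integral :: "(real \<Rightarrow> complex) \<Rightarrow> real \<Rightarrow> complex" where
  "fourier_integral h \<xi> = (\<integral>x. exp (- \<i> * of_real (x * \<xi>)) * h x \<partial>lborel)"

lemma measurable_fourier_integral [measurable]:
  assumes [measurable]: "h \<in> borel_measurable borel"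
  shows "fourier_integral h \<in> borel_measurable borel"
  unfolding fourier_integral_def[abs_def] by measurable

text \<open>
  Two applications of Fubini's theorem, made possible by the Gaussian weight, turn the left-hand
  side into \<open>2 \<pi> \<integral>\<integral> h(x) cnj(h(y)) G(y - x) dy dx\<close> with the centred normal density \<open>G\<close> of standard
  deviation \<open>s\<close>. Since \<open>2 \<bar>h(x) h(y)\<bar> \<le> \<bar>h(x)\<bar>\<^sup>2 + \<bar>h(y)\<bar>\<^sup>2\<close> and \<open>G\<close> has mass \<open>1\<close> in either variable,
  this is at most \<open>2 \<pi> \<integral> \<bar>h\<bar>\<^sup>2\<close>, whatever \<open>s\<close>.
\<close>

lemma gaussian_weighted_fourier_bound:
  assumes h: "integrable lborel h" and s: "s > 0"
  shows "(\<integral>\<^sup>+\<xi>. ennreal ((cmod (fourier_integral h \<xi>))\<^sup>2 * exp (- (s * \<xi>)\<^sup>2 / 2)) \<partial>lborel)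
           \<le> ennreal (2 * pi) * (\<integral>\<^sup>+x. ennreal ((cmod (h x))\<^sup>2) \<partial>lborel)"
proof -
  have h_meas [measurable]: "h \<in> borel_measurable borel"
    using borel_measurable_integrable[OF h] by simp
  define F where "F = fourier_integral h"
  have F_meas [measurable]: "F \<in> borel_measurable borel" unfolding F_def by simp
  define K where "K \<xi> = exp (- (s * \<xi>)\<^sup>2 / 2)" for \<xi> :: real
  have K_int: "integrable lborel K"
    unfolding K_def[abs_def] by (rule gaussian_scaled_integrable[OF s])
  have K_meas [measurable]: "K \<in> borel_measurable borel" unfolding K_def[abs_def] by measurable
  have K_pos: "0 \<le> K \<xi>" for \<xi> by (simp add: K_def)
  define G where "G u = normal_density 0 s u" for u
  have G_meas [measurable]: "G \<in> borel_measurable borel" unfolding G_def[abs_def] by measurable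
  have G_pos: "0 \<le> G u" for u by (simp add: G_def)
  define e where "e u = exp (\<i> * complex_of_real u)" for u
  have e_meas [measurable]: "e \<in> borel_measurable borel" unfolding e_def[abs_def] by measurable
  have norm_e [simp]: "cmod (e u) = 1" for u by (simp add: e_def)
  have F_eq: "F \<xi> = (\<integral>x. e (- (x * \<xi>)) * h x \<partial>lborel)" for \<xi>
    by (simp add: F_def fourier_integral_def e_def)
  have cnj_F: "cnj (F \<xi>) = (\<integral>y. e (y * \<xi>) * cnj (h y) \<partial>lborel)" for \<xi>
    unfolding F_eq by (subst Bochner_Integration.integral_cnj[symmetric]) (simp add: e_def exp_cnj)
  define B where "B = (\<integral>x. cmod (h x) \<partial>lborel)"
  have F_bound: "cmod (F \<xi>) \<le> B" for \<xi>
    unfolding F_eq B_def by (rule order_trans[OF integral_norm_bound]) (simp add: norm_mult)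
  have h_norm: "integrable lborel (\<lambda>x. cmod (h x))" using h by simp

  have sq_int: "integrable lborel (\<lambda>\<xi>. (cmod (F \<xi>))\<^sup>2 * K \<xi>)"
  proof (rule Bochner_Integration.integrable_bound)
    show "integrable lborel (\<lambda>\<xi>. B\<^sup>2 * K \<xi>)" using K_int by simp
    show "AE \<xi> in lborel. norm ((cmod (F \<xi>))\<^sup>2 * K \<xi>) \<le> norm (B\<^sup>2 * K \<xi>)"
      using F_bound K_pos by (auto intro!: mult_right_mono power_mono)
  qed measurable
  define I where "I = (\<integral>\<xi>. (cmod (F \<xi>))\<^sup>2 * K \<xi> \<partial>lborel)"
  have I_pos: "0 \<le> I" unfolding I_def by (simp add: K_pos)

  have inner: "(\<integral>\<xi>. e (- (x * \<xi>)) * cnj (F \<xi>) * of_real (K \<xi>) \<partial>lborel) =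
               (\<integral>y. cnj (h y) * of_real (2 * pi * G (y - x)) \<partial>lborel)" for x
  proof -
    have "(\<integral>\<xi>. e (- (x * \<xi>)) * cnj (F \<xi>) * of_real (K \<xi>) \<partial>lborel) =
          (\<integral>\<xi>. \<integral>y. cnj (h y) * (e ((y - x) * \<xi>) * of_real (K \<xi>)) \<partial>lborel \<partial>lborel)"
    proof (rule Bochner_Integration.integral_cong[OF refl])
      fix \<xi>
      have "e (- (x * \<xi>)) * cnj (F \<xi>) * of_real (K \<xi>) =
            (\<integral>y. (e (- (x * \<xi>)) * of_real (K \<xi>)) * (e (y * \<xi>) * cnj (h y)) \<partial>lborel)"
        unfolding cnj_F by (subst integral_mult_right_zero) (simp add: mult_ac)
      also have "\<dots> = (\<integral>y. cnj (h y) * (e ((y - x) * \<xi>) * of_real (K \<xi>)) \<partial>lborel)"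
        by (intro Bochner_Integration.integral_cong)
           (auto simp: e_def algebra_simps simp flip: exp_add)
      finally show "e (- (x * \<xi>)) * cnj (F \<xi>) * of_real (K \<xi>) = \<dots>" .
    qed
    also have "\<dots> = (\<integral>y. \<integral>\<xi>. cnj (h y) * (e ((y - x) * \<xi>) * of_real (K \<xi>)) \<partial>lborel \<partial>lborel)"
    proof (rule lborel_pair.Fubini_integral)
      show "integrable (lborel \<Otimes>\<^sub>M lborel)
              (\<lambda>(y, \<xi>). cnj (h y) * (e ((y - x) * \<xi>) * of_real (K \<xi>)))"
        by (rule Bochner_Integration.integrable_bound[OF integrable_lborel_product[OF h_norm K_int]])
           (auto simp: norm_mult K_pos)
    qed
    also have "\<dots> = (\<integral>y. cnj (h y) * of_real (2 * pi * G (y - x)) \<partial>lborel)"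
      unfolding e_def K_def G_def fourier_gaussian[OF s, symmetric]
      by (subst integral_mult_right_zero) (rule refl)
    finally show ?thesis .
  qed
  have "complex_of_real I = (\<integral>\<xi>. of_real ((cmod (F \<xi>))\<^sup>2 * K \<xi>) \<partial>lborel)"
    unfolding I_def by (rule integral_complex_of_real[symmetric])
  also have "\<dots> = (\<integral>\<xi>. \<integral>x. h x * (e (- (x * \<xi>)) * cnj (F \<xi>) * of_real (K \<xi>)) \<partial>lborel \<partial>lborel)"
  proof (rule Bochner_Integration.integral_cong[OF refl])
    fix \<xi>
    have "of_real ((cmod (F \<xi>))\<^sup>2 * K \<xi>) = (cnj (F \<xi>) * of_real (K \<xi>)) * F \<xi>"
      by (simp add: complex_norm_square mult_ac del: of_real_power)
    also have "\<dots> = (\<integral>x. (cnj (F \<xi>) * of_real (K \<xi>)) * (e (- (x * \<xi>)) * h x) \<partial>lborel)"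
      by (subst (2) F_eq) simp
    finally show "of_real ((cmod (F \<xi>))\<^sup>2 * K \<xi>) =
        (\<integral>x. h x * (e (- (x * \<xi>)) * cnj (F \<xi>) * of_real (K \<xi>)) \<partial>lborel)"
      by (simp only: mult_ac)
  qed
  also have "\<dots> = (\<integral>x. \<integral>\<xi>. h x * (e (- (x * \<xi>)) * cnj (F \<xi>) * of_real (K \<xi>)) \<partial>lborel \<partial>lborel)"
  proof (rule lborel_pair.Fubini_integral)
    have BK: "integrable lborel (\<lambda>\<xi>. B * K \<xi>)" using K_int by simp
    have "cmod (h x) * (cmod (F \<xi>) * K \<xi>) \<le> \<bar>cmod (h x) * (B * K \<xi>)\<bar>" for x \<xi>
      by (rule order_trans[OF _ abs_ge_self])
         (intro mult_left_mono mult_right_mono F_bound K_pos norm_ge_zero)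
    then show "integrable (lborel \<Otimes>\<^sub>M lborel)
            (\<lambda>(x, \<xi>). h x * (e (- (x * \<xi>)) * cnj (F \<xi>) * of_real (K \<xi>)))"
      by (intro Bochner_Integration.integrable_bound[OF integrable_lborel_product[OF h_norm BK]])
         (auto simp: norm_mult K_pos)
  qed
  also have "\<dots> = (\<integral>x. h x * (\<integral>y. cnj (h y) * of_real (2 * pi * G (y - x)) \<partial>lborel) \<partial>lborel)"
    by (simp add: inner)
  finally have I_eq: "complex_of_real I = \<dots>" .

  have "ennreal I = ennreal (cmod (complex_of_real I))" using I_pos by simp
  also have "\<dots> \<le> (\<integral>\<^sup>+x. ennreal (cmod (h x * (\<integral>y. cnj (h y) * of_real (2 * pi * G (y - x)) \<partial>lborel))) \<partial>lborel)"
    unfolding I_eq by (rule norm_integral_le_nn_integral)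
  also have "\<dots> \<le> (\<integral>\<^sup>+x. \<integral>\<^sup>+y. ennreal (cmod (h x) * (cmod (h y) * (2 * pi * G (y - x)))) \<partial>lborel \<partial>lborel)"
  proof (rule nn_integral_mono)
    fix x
    have "ennreal (cmod (h x * (\<integral>y. cnj (h y) * of_real (2 * pi * G (y - x)) \<partial>lborel)))
        \<le> ennreal (cmod (h x)) * (\<integral>\<^sup>+y. ennreal (cmod (cnj (h y) * of_real (2 * pi * G (y - x)))) \<partial>lborel)"
      unfolding norm_mult[of "h x"] by (subst ennreal_mult) (auto intro!: mult_left_mono norm_integral_le_nn_integral)
    also have "\<dots> = (\<integral>\<^sup>+y. ennreal (cmod (h x) * (cmod (h y) * (2 * pi * G (y - x)))) \<partial>lborel)"
      by (subst nn_integral_cmult[symmetric]) (auto simp: norm_mult abs_mult G_pos ennreal_mult'')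
    finally show "ennreal (cmod (h x * (\<integral>y. cnj (h y) * of_real (2 * pi * G (y - x)) \<partial>lborel))) \<le> \<dots>" .
  qed
  also have "\<dots> \<le> (\<integral>\<^sup>+x. \<integral>\<^sup>+y. (ennreal (pi * (cmod (h x))\<^sup>2) * ennreal (G (y - x))
                     + ennreal (pi * (cmod (h y))\<^sup>2) * ennreal (G (y - x))) \<partial>lborel \<partial>lborel)"
  proof (intro nn_integral_mono)
    fix x y
    have "2 * cmod (h x) * cmod (h y) \<le> (cmod (h x))\<^sup>2 + (cmod (h y))\<^sup>2"
      by (rule sum_squares_bound)
    from mult_right_mono[OF this, of "pi * G (y - x)"]
    have "cmod (h x) * (cmod (h y) * (2 * pi * G (y - x)))
        \<le> pi * (cmod (h x))\<^sup>2 * G (y - x) + pi * (cmod (h y))\<^sup>2 * G (y - x)"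
      using G_pos by (simp add: algebra_simps)
    then show "ennreal (cmod (h x) * (cmod (h y) * (2 * pi * G (y - x))))
        \<le> ennreal (pi * (cmod (h x))\<^sup>2) * ennreal (G (y - x))
          + ennreal (pi * (cmod (h y))\<^sup>2) * ennreal (G (y - x))"
      by (simp add: G_pos flip: ennreal_mult'' ennreal_plus)
  qed
  also have "\<dots> = (\<integral>\<^sup>+x. \<integral>\<^sup>+y. ennreal (pi * (cmod (h x))\<^sup>2) * ennreal (G (y - x)) \<partial>lborel \<partial>lborel)
       + (\<integral>\<^sup>+x. \<integral>\<^sup>+y. ennreal (pi * (cmod (h y))\<^sup>2) * ennreal (G (y - x)) \<partial>lborel \<partial>lborel)"
    by (simp add: nn_integral_add)
  also have "(\<integral>\<^sup>+x. \<integral>\<^sup>+y. ennreal (pi * (cmod (h y))\<^sup>2) * ennreal (G (y - x)) \<partial>lborel \<partial>lborel)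
      = (\<integral>\<^sup>+y. \<integral>\<^sup>+x. ennreal (pi * (cmod (h y))\<^sup>2) * ennreal (G (y - x)) \<partial>lborel \<partial>lborel)"
    by (rule lborel_pair.Fubini') measurable
  also have "\<dots> = ennreal pi * (\<integral>\<^sup>+y. ennreal ((cmod (h y))\<^sup>2) \<partial>lborel)"
    by (simp add: nn_integral_cmult G_def nn_integral_normal_density_shift[OF s] ennreal_mult)
  also have "(\<integral>\<^sup>+x. \<integral>\<^sup>+y. ennreal (pi * (cmod (h x))\<^sup>2) * ennreal (G (y - x)) \<partial>lborel \<partial>lborel)
      = ennreal pi * (\<integral>\<^sup>+y. ennreal ((cmod (h y))\<^sup>2) \<partial>lborel)"
    by (simp add: nn_integral_cmult G_def nn_integral_normal_density_shift[OF s] ennreal_mult)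
  also have "ennreal pi * (\<integral>\<^sup>+y. ennreal ((cmod (h y))\<^sup>2) \<partial>lborel)
      + ennreal pi * (\<integral>\<^sup>+y. ennreal ((cmod (h y))\<^sup>2) \<partial>lborel)
      = ennreal (2 * pi) * (\<integral>\<^sup>+x. ennreal ((cmod (h x))\<^sup>2) \<partial>lborel)"
    by (simp add: flip: distrib_right ennreal_plus)
  also have "ennreal I = (\<integral>\<^sup>+\<xi>. ennreal ((cmod (F \<xi>))\<^sup>2 * K \<xi>) \<partial>lborel)"
    unfolding I_def by (rule nn_integral_eq_integral[symmetric, OF sq_int]) (simp add: K_pos)
  finally show ?thesis by (simp only: F_def K_def)
qed

text \<open>
  The weight tends to \<open>1\<close> as \<open>s\<close> tends to \<open>0\<close>, and Fatou's lemma removes it. If \<open>h\<close> is not square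
  integrable, the right-hand side is infinite.
\<close>

lemma fourier_integral_bessel:
  assumes h: "integrable lborel h"
  shows "(\<integral>\<^sup>+\<xi>. ennreal ((cmod (fourier_integral h \<xi>))\<^sup>2) \<partial>lborel)
           \<le> ennreal (2 * pi) * (\<integral>\<^sup>+x. ennreal ((cmod (h x))\<^sup>2) \<partial>lborel)" (is "_ \<le> ?R")
proof -
  have [measurable]: "h \<in> borel_measurable borel"
    using borel_measurable_integrable[OF h] by simp
  define u where "u n \<xi> = ennreal ((cmod (fourier_integral h \<xi>))\<^sup>2 * exp (- (inverse (real (Suc n)) * \<xi>)\<^sup>2 / 2))"
    for n \<xi>
  have "(\<lambda>n. (cmod (fourier_integral h \<xi>))\<^sup>2 * exp (- (inverse (real (Suc n)) * \<xi>)\<^sup>2 / 2))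
          \<longlonglongrightarrow> (cmod (fourier_integral h \<xi>))\<^sup>2 * exp (- (0 * \<xi>)\<^sup>2 / 2)" for \<xi>
    by (intro tendsto_intros LIMSEQ_inverse_real_of_nat) simp
  then have "(\<lambda>n. u n \<xi>) \<longlonglongrightarrow> ennreal ((cmod (fourier_integral h \<xi>))\<^sup>2)" for \<xi>
    unfolding u_def by (intro tendsto_ennrealI) simp
  then have "ennreal ((cmod (fourier_integral h \<xi>))\<^sup>2) = liminf (\<lambda>n. u n \<xi>)" for \<xi>
    by (rule lim_imp_Liminf[OF sequentially_bot, symmetric])
  then have "(\<integral>\<^sup>+\<xi>. ennreal ((cmod (fourier_integral h \<xi>))\<^sup>2) \<partial>lborel) = (\<integral>\<^sup>+\<xi>. liminf (\<lambda>n. u n \<xi>) \<partial>lborel)"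
    by simp
  also have "\<dots> \<le> liminf (\<lambda>n. \<integral>\<^sup>+\<xi>. u n \<xi> \<partial>lborel)"
    by (rule nn_integral_liminf) (simp add: u_def)
  also have "\<dots> \<le> liminf (\<lambda>n. ?R)"
    unfolding u_def
    by (intro Liminf_mono always_eventually allI gaussian_weighted_fourier_bound[OF h]) simp
  finally show ?thesis by (simp add: Liminf_const)
qed

section \<open>The Fourier transform in \<open>L\<^sup>2\<close> and the energy\<close>

lemma L2_restrict_integrable:
  assumes "L2 f"
  shows "integrable lborel (\<lambda>x. indicator {-R..R} x *\<^sub>R f x)"
proof (rule Bochner_Integration.integrable_bound)
  have [measurable]: "f \<in> borel_measurable borel" and sq: "integrable lborel (\<lambda>x. (norm (f x))\<^sup>2)"
    using assms by (simp_all add: L2_def)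
  show "(\<lambda>x. indicator {-R..R} x *\<^sub>R f x) \<in> borel_measurable lborel" by measurable
  show "integrable lborel (\<lambda>x. indicator {-R..R} x + (norm (f x))\<^sup>2 :: real)"
    using sq by (intro Bochner_Integration.integrable_add integrable_real_indicator) (auto simp: emeasure_lborel_Icc_eq)
  have "norm (f x) \<le> 1 + (norm (f x))\<^sup>2" for x
    using sum_squares_bound[of 1 "norm (f x)"] norm_ge_zero[of "f x"] unfolding one_power2 by linarith
  then show "AE x in lborel. norm (indicator {-R..R} x *\<^sub>R f x)
               \<le> norm (indicator {-R..R} x + (norm (f x))\<^sup>2 :: real)"
    by (auto simp: indicator_def)
qed

lemma truncated_fourier_eq:
  "truncated_fourier R f \<xi> =
     of_real (1 / sqrt (2 * pi)) * fourier_integral (\<lambda>x. indicator {-R..R} x *\<^sub>R f x) \<xi>"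
  unfolding truncated_fourier_def fourier_integral_def set_lebesgue_integral_def by simp

lemma truncated_fourier_bessel:
  assumes "L2 f"
  shows "(\<integral>\<^sup>+\<xi>. ennreal ((cmod (truncated_fourier R f \<xi>))\<^sup>2) \<partial>lborel)
           \<le> (\<integral>\<^sup>+x. ennreal ((cmod (f x))\<^sup>2) \<partial>lborel)"
proof -
  have [measurable]: "f \<in> borel_measurable borel" using assms by (simp add: L2_def)
  define h where "h x = indicator {-R..R} x *\<^sub>R f x" for x
  have h: "integrable lborel h" unfolding h_def[abs_def] by (rule L2_restrict_integrable[OF assms])
  have [measurable]: "h \<in> borel_measurable borel" unfolding h_def[abs_def] by measurable
  have "(cmod (truncated_fourier R f \<xi>))\<^sup>2 = 1 / (2 * pi) * (cmod (fourier_integral h \<xi>))\<^sup>2" for \<xi>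
    by (simp add: truncated_fourier_eq h_def[abs_def] norm_mult norm_divide power_mult_distrib
        power_divide del: of_real_divide)
  then have "(\<integral>\<^sup>+\<xi>. ennreal ((cmod (truncated_fourier R f \<xi>))\<^sup>2) \<partial>lborel) =
        (\<integral>\<^sup>+\<xi>. ennreal (1 / (2 * pi)) * ennreal ((cmod (fourier_integral h \<xi>))\<^sup>2) \<partial>lborel)"
    by (simp flip: ennreal_mult'')
  also have "\<dots> = ennreal (1 / (2 * pi)) * (\<integral>\<^sup>+\<xi>. ennreal ((cmod (fourier_integral h \<xi>))\<^sup>2) \<partial>lborel)"
    by (rule nn_integral_cmult) measurable
  also have "\<dots> \<le> ennreal (1 / (2 * pi)) * (ennreal (2 * pi) * (\<integral>\<^sup>+x. ennreal ((cmod (h x))\<^sup>2) \<partial>lborel))"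
    by (intro mult_left_mono fourier_integral_bessel h) simp
  also have "\<dots> = (\<integral>\<^sup>+x. ennreal ((cmod (h x))\<^sup>2) \<partial>lborel)"
    by (simp flip: mult.assoc ennreal_mult'')
  also have "\<dots> \<le> (\<integral>\<^sup>+x. ennreal ((cmod (f x))\<^sup>2) \<partial>lborel)"
    by (intro nn_integral_mono ennreal_leI) (auto simp: h_def indicator_def)
  finally show ?thesis .
qed

lemma nn_integral_norm_sq_L2:
  assumes "L2 f"
  shows "(\<integral>\<^sup>+x. ennreal ((norm (f x))\<^sup>2) \<partial>lborel) = ennreal ((L2_norm f)\<^sup>2)"
  using assms by (simp add: L2_def L2_norm_def nn_integral_eq_integral)

text \<open>
  A triangle inequality for squared norms, with a factor in front of \<open>\<parallel>u\<parallel>\<^sup>2\<close> that can be brought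
  close to \<open>1\<close>; the square roots of \<open>L\<^sup>2\<close> integrals are thereby avoided.
\<close>

lemma norm_sq_le_weighted:
  fixes u v :: "'a::real_normed_vector"
  assumes "\<eta> > 0"
  shows "(norm v)\<^sup>2 \<le> (1 + \<eta>) * (norm u)\<^sup>2 + (1 + 1 / \<eta>) * (norm (u - v))\<^sup>2"
proof -
  define p q where "p = norm u" and "q = norm (u - v)"
  have "norm v \<le> p + q"
    unfolding p_def q_def by (metis norm_minus_commute norm_triangle_sub)
  then have "(norm v)\<^sup>2 \<le> (p + q)\<^sup>2" by (rule power_mono) simp
  also have "(p + q)\<^sup>2 \<le> (1 + \<eta>) * p\<^sup>2 + (1 + 1 / \<eta>) * q\<^sup>2"
  proof -
    have "0 \<le> (\<eta> * p - q)\<^sup>2 / \<eta>" using assms by simp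
    also have "(\<eta> * p - q)\<^sup>2 / \<eta> = (1 + \<eta>) * p\<^sup>2 + (1 + 1 / \<eta>) * q\<^sup>2 - (p + q)\<^sup>2"
      using assms by (simp add: field_simps power2_eq_square)
    finally show ?thesis by simp
  qed
  finally show ?thesis by (simp only: p_def q_def)
qed

text \<open>
  The bound holds for the transforms of all truncations and survives the limit in \<open>L\<^sup>2\<close>: by the
  weighted triangle inequality it first holds up to a factor \<open>1 + \<eta>\<close>, for every \<open>\<eta> > 0\<close>.
\<close>

lemma L2_fourier_bessel:
  assumes "has_L2_fourier f g"
  shows "L2_norm g \<le> L2_norm f"
proof -
  have f: "L2 f" and g: "L2 g" and lim:
    "((\<lambda>R. \<integral>\<^sup>+ \<xi>. ennreal ((norm (truncated_fourier R f \<xi> - g \<xi>))\<^sup>2) \<partial>lborel) \<longlongrightarrow> 0) at_top"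
    using assms by (auto simp: has_L2_fourier_def)
  have [measurable]: "f \<in> borel_measurable borel" "g \<in> borel_measurable borel"
    using f g by (simp_all add: L2_def)
  have [measurable]: "truncated_fourier R f \<in> borel_measurable borel" for R
    unfolding truncated_fourier_eq[abs_def] by measurable
  define F G where "F = (L2_norm f)\<^sup>2" and "G = (L2_norm g)\<^sup>2"
  have "F \<ge> 0" by (simp add: F_def)
  have approx: "G \<le> (1 + \<eta>) * F" if \<eta>: "\<eta> > 0" for \<eta>
  proof -
    let ?e = "\<lambda>R. \<integral>\<^sup>+ \<xi>. ennreal ((norm (truncated_fourier R f \<xi> - g \<xi>))\<^sup>2) \<partial>lborel"
    have "ennreal G \<le> ennreal ((1 + \<eta>) * F) + ennreal (1 + 1 / \<eta>) * ?e R" for R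
    proof -
      have "ennreal G = (\<integral>\<^sup>+\<xi>. ennreal ((norm (g \<xi>))\<^sup>2) \<partial>lborel)"
        by (simp add: G_def nn_integral_norm_sq_L2[OF g])
      also have "\<dots> \<le> (\<integral>\<^sup>+\<xi>. ennreal (1 + \<eta>) * ennreal ((norm (truncated_fourier R f \<xi>))\<^sup>2)
            + ennreal (1 + 1 / \<eta>) * ennreal ((norm (truncated_fourier R f \<xi> - g \<xi>))\<^sup>2) \<partial>lborel)"
        using norm_sq_le_weighted[OF \<eta>] \<eta>
        by (intro nn_integral_mono) (simp add: ennreal_leI flip: ennreal_mult ennreal_plus)
      also have "\<dots> = ennreal (1 + \<eta>) * (\<integral>\<^sup>+\<xi>. ennreal ((norm (truncated_fourier R f \<xi>))\<^sup>2) \<partial>lborel)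
            + ennreal (1 + 1 / \<eta>) * ?e R"
        by (simp add: nn_integral_add nn_integral_cmult)
      also have "\<dots> \<le> ennreal (1 + \<eta>) * ennreal F + ennreal (1 + 1 / \<eta>) * ?e R"
        using truncated_fourier_bessel[OF f, of R] nn_integral_norm_sq_L2[OF f]
        by (intro add_right_mono mult_left_mono) (simp_all add: F_def)
      finally show ?thesis using \<eta> \<open>F \<ge> 0\<close> by (simp add: ennreal_mult)
    qed
    moreover have "((\<lambda>R. ennreal ((1 + \<eta>) * F) + ennreal (1 + 1 / \<eta>) * ?e R)
                     \<longlongrightarrow> ennreal ((1 + \<eta>) * F) + ennreal (1 + 1 / \<eta>) * 0) at_top"
      by (intro tendsto_add tendsto_const ennreal_tendsto_cmult lim) simp
    ultimately have "ennreal G \<le> ennreal ((1 + \<eta>) * F) + ennreal (1 + 1 / \<eta>) * 0"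
      by (intro tendsto_lowerbound[OF _ always_eventually]) auto
    then show ?thesis using \<eta> \<open>F \<ge> 0\<close> by (simp add: ennreal_le_iff)
  qed
  have "G \<le> F"
  proof (rule field_le_epsilon)
    fix e :: real assume "e > 0"
    then have "G \<le> (1 + e / (F + 1)) * F" using \<open>F \<ge> 0\<close> by (intro approx) simp
    also have "\<dots> \<le> F + e" using \<open>F \<ge> 0\<close> \<open>e > 0\<close> by (simp add: field_simps)
    finally show "G \<le> F + e" .
  qed
  then show ?thesis
    unfolding F_def G_def by (rule power2_le_imp_le) (simp add: L2_norm_def)
qed

lemma L2_fourier_vec_bessel:
  assumes f: "L2 f" and fg: "has_L2_fourier_vec f g"
  shows "(\<integral>\<^sup>+\<xi>. ennreal ((norm (g \<xi>))\<^sup>2) \<partial>lborel) \<le> ennreal ((L2_norm f)\<^sup>2)"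
proof -
  have comp: "has_L2_fourier (\<lambda>x. f x $ j) (\<lambda>\<xi>. g \<xi> $ j)" for j
    using fg by (simp add: has_L2_fourier_vec_def)
  have [measurable]: "(\<lambda>x. f x $ j) \<in> borel_measurable borel" "(\<lambda>x. g x $ j) \<in> borel_measurable borel" for j
    using comp[of j] by (simp_all add: has_L2_fourier_def L2_def)
  have split: "(\<integral>\<^sup>+\<xi>. ennreal ((norm (k \<xi>))\<^sup>2) \<partial>lborel) =
       (\<integral>\<^sup>+\<xi>. ennreal ((cmod (k \<xi> $ 1))\<^sup>2) \<partial>lborel) + (\<integral>\<^sup>+\<xi>. ennreal ((cmod (k \<xi> $ 2))\<^sup>2) \<partial>lborel)"
    if [measurable]: "\<And>j. (\<lambda>\<xi>. k \<xi> $ j) \<in> borel_measurable borel" for k :: "real \<Rightarrow> complex^2"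
    by (simp add: norm_sq_complex2 nn_integral_add)
  have "(\<integral>\<^sup>+\<xi>. ennreal ((cmod (g \<xi> $ j))\<^sup>2) \<partial>lborel) \<le> (\<integral>\<^sup>+x. ennreal ((cmod (f x $ j))\<^sup>2) \<partial>lborel)" for j
    using comp[of j] L2_fourier_bessel[OF comp[of j]]
    by (simp add: nn_integral_norm_sq_L2 has_L2_fourier_def ennreal_leI L2_norm_def)
  then have "(\<integral>\<^sup>+\<xi>. ennreal ((norm (g \<xi>))\<^sup>2) \<partial>lborel) \<le> (\<integral>\<^sup>+x. ennreal ((norm (f x))\<^sup>2) \<partial>lborel)"
    by (simp add: split add_mono)
  then show ?thesis by (simp add: nn_integral_norm_sq_L2[OF f])
qed

text \<open>
  The complement of the essential support is a union of possibly uncountably many open sets on each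
  of which \<open>f\<close> vanishes almost everywhere; compactness leaves finitely many of them.
\<close>

lemma AE_zero_on_compact:
  fixes f :: "real \<Rightarrow> 'a::euclidean_space"
  assumes "compact K" "ess_support f \<inter> K = {}"
  shows "AE \<xi> in lborel. \<xi> \<in> K \<longrightarrow> f \<xi> = 0"
proof -
  let ?\<U> = "{U. open U \<and> (AE \<xi> in lborel. \<xi> \<in> U \<longrightarrow> f \<xi> = 0)}"
  have "K \<subseteq> \<Union>?\<U>" using assms(2) by (auto simp: ess_support_def)
  then obtain D where D: "D \<subseteq> ?\<U>" "finite D" "K \<subseteq> \<Union>D"
    using compactE[OF assms(1)] by (metis (no_types, lifting) mem_Collect_eq)
  have "AE \<xi> in lborel. \<forall>U\<in>D. \<xi> \<in> U \<longrightarrow> f \<xi> = 0"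
    using D by (subst AE_finite_all) auto
  then show ?thesis
    by (rule AE_mp) (use D(3) in \<open>auto intro!: AE_I2\<close>)
qed

lemma energy_decay:
  assumes Y0: "L2 Y0" "has_L2_fourier_vec Y0 Y0_hat"
    and supp: "ess_support Y0_hat \<subseteq> UNIV - {-\<delta>..\<delta>}"
    and decay: "\<And>\<xi>. \<delta> < \<bar>\<xi>\<bar> \<Longrightarrow> opnorm (mexp (- (t *\<^sub>R A \<nu> a b c d \<xi>))) \<le> exp (- \<beta> * t)"
  shows "energy \<nu> a b c d Y0_hat t \<le> ennreal (exp (- 2 * \<beta> * t) * (L2_norm Y0)\<^sup>2)"
proof -
  have meas: "(\<lambda>\<xi>. Y0_hat \<xi> $ j) \<in> borel_measurable borel" for j
    using Y0(2) by (simp add: has_L2_fourier_vec_def has_L2_fourier_def L2_def)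
  have "AE \<xi> in lborel. \<xi> \<in> {-\<delta>..\<delta>} \<longrightarrow> Y0_hat \<xi> = 0"
    using supp by (intro AE_zero_on_compact) auto
  then have "AE \<xi> in lborel. ennreal ((norm (Y_hat \<nu> a b c d Y0_hat t \<xi>))\<^sup>2)
       \<le> ennreal (exp (- 2 * \<beta> * t)) * ennreal ((norm (Y0_hat \<xi>))\<^sup>2)"
  proof (rule AE_mp, intro AE_I2 impI)
    fix \<xi> assume zero: "\<xi> \<in> {-\<delta>..\<delta>} \<longrightarrow> Y0_hat \<xi> = 0"
    have "norm (Y_hat \<nu> a b c d Y0_hat t \<xi>) \<le> exp (- \<beta> * t) * norm (Y0_hat \<xi>)"
    proof (cases "\<xi> \<in> {-\<delta>..\<delta>}")
      case True
      with zero show ?thesis by (simp add: Y_hat_def matrix_vector_mult_0_right)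
    next
      case False
      then have "\<delta> < \<bar>\<xi>\<bar>" by auto
      then show ?thesis
        unfolding Y_hat_def
        by (intro order_trans[OF norm_mexp_apply_le] mult_right_mono decay) auto
    qed
    then have "(norm (Y_hat \<nu> a b c d Y0_hat t \<xi>))\<^sup>2 \<le> (exp (- \<beta> * t) * norm (Y0_hat \<xi>))\<^sup>2"
      by (rule power_mono) simp
    also have "\<dots> = exp (- 2 * \<beta> * t) * (norm (Y0_hat \<xi>))\<^sup>2"
      by (simp add: power_mult_distrib mult.assoc flip: exp_double)
    finally show "ennreal ((norm (Y_hat \<nu> a b c d Y0_hat t \<xi>))\<^sup>2)
       \<le> ennreal (exp (- 2 * \<beta> * t)) * ennreal ((norm (Y0_hat \<xi>))\<^sup>2)"
      by (simp add: ennreal_leI flip: ennreal_mult)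
  qed
  then have "energy \<nu> a b c d Y0_hat t
      \<le> (\<integral>\<^sup>+\<xi>. ennreal (exp (- 2 * \<beta> * t)) * ennreal ((norm (Y0_hat \<xi>))\<^sup>2) \<partial>lborel)"
    unfolding energy_def by (rule nn_integral_mono_AE)
  also have "\<dots> = ennreal (exp (- 2 * \<beta> * t)) * (\<integral>\<^sup>+\<xi>. ennreal ((norm (Y0_hat \<xi>))\<^sup>2) \<partial>lborel)"
    using meas by (subst nn_integral_cmult) (auto simp: norm_sq_complex2)
  also have "\<dots> \<le> ennreal (exp (- 2 * \<beta> * t)) * ennreal ((L2_norm Y0)\<^sup>2)"
    by (intro mult_left_mono L2_fourier_vec_bessel Y0) simp
  finally show ?thesis by (simp add: ennreal_mult)
qed

section \<open>The order of the symbol\<close>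

text \<open>
  The hypotheses are symmetric, so that equality follows by antisymmetry. If \<open>m' < m\<close>, the quotient of the two
  equivalents would tend both to \<open>1\<close> and to \<open>0\<close>.
\<close>

lemma has_growth_order_le:
  assumes "has_growth_order \<kappa> m" "has_growth_order \<kappa> m'"
  shows "m \<le> m'"
proof (rule ccontr)
  assume "\<not> m \<le> m'"
  then have less: "m' < m" by simp
  obtain C C' where C: "C > 0" "\<kappa> \<sim>[at_infinity] (\<lambda>\<xi>. C * \<bar>\<xi>\<bar> powr m)"
    and C': "C' > 0" "\<kappa> \<sim>[at_infinity] (\<lambda>\<xi>. C' * \<bar>\<xi>\<bar> powr m')"
    using assms by (auto simp: has_growth_order_def)
  have "(\<lambda>\<xi>. C' * \<bar>\<xi>\<bar> powr m') \<sim>[at_infinity] (\<lambda>\<xi>. C * \<bar>\<xi>\<bar> powr m)"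
    using C(2) C'(2) by (meson asymp_equiv_sym asymp_equiv_trans)
  moreover have "eventually (\<lambda>\<xi>::real. C' * \<bar>\<xi>\<bar> powr m' \<noteq> 0 \<or> C * \<bar>\<xi>\<bar> powr m \<noteq> 0) at_infinity"
    using C by (auto simp: eventually_at_infinity intro!: exI[of _ 1])
  ultimately have "((\<lambda>\<xi>. C' * \<bar>\<xi>\<bar> powr m' / (C * \<bar>\<xi>\<bar> powr m)) \<longlongrightarrow> 1) at_infinity"
    by (rule asymp_equivD_strong)
  then have lim1: "((\<lambda>\<xi>. C' * \<bar>\<xi>\<bar> powr m' / (C * \<bar>\<xi>\<bar> powr m)) \<longlongrightarrow> 1) at_top"
    by (rule tendsto_mono[OF at_top_le_at_infinity])
  have "((\<lambda>\<xi>. C' * \<bar>\<xi>\<bar> powr m' / (C * \<bar>\<xi>\<bar> powr m)) \<longlongrightarrow> C' / C * 0) at_top"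
  proof (rule Lim_transform_eventually)
    show "((\<lambda>\<xi>::real. C' / C * \<xi> powr (m' - m)) \<longlongrightarrow> C' / C * 0) at_top"
      using less by (intro tendsto_intros tendsto_neg_powr filterlim_ident) auto
    show "\<forall>\<^sub>F \<xi> in at_top. C' / C * \<xi> powr (m' - m) = C' * \<bar>\<xi>\<bar> powr m' / (C * \<bar>\<xi>\<bar> powr m)"
      using eventually_gt_at_top[of 0] by eventually_elim (simp add: powr_diff)
  qed
  from tendsto_unique[OF trivial_limit_at_top_linorder lim1 this] show False by simp
qed

lemma growth_order_eqI:
  assumes "has_growth_order \<kappa> m"
  shows "growth_order \<kappa> = m"
  unfolding growth_order_def
  using assms by (intro the_equality) (auto intro: antisym has_growth_order_le)

lemma has_growth_order_bounds:
  assumes "has_growth_order \<kappa> m"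
  obtains k K X where "0 < k" "0 < K" "1 \<le> X"
    "\<And>\<xi>. X < \<bar>\<xi>\<bar> \<Longrightarrow> k * \<bar>\<xi>\<bar> powr m \<le> \<kappa> \<xi>" "\<And>\<xi>. X < \<bar>\<xi>\<bar> \<Longrightarrow> \<kappa> \<xi> \<le> K * \<bar>\<xi>\<bar> powr m"
proof -
  obtain C where C: "C > 0" "\<kappa> \<sim>[at_infinity] (\<lambda>\<xi>. C * \<bar>\<xi>\<bar> powr m)"
    using assms by (auto simp: has_growth_order_def)
  have "eventually (\<lambda>\<xi>::real. \<kappa> \<xi> \<noteq> 0 \<or> C * \<bar>\<xi>\<bar> powr m \<noteq> 0) at_infinity"
    using C by (auto simp: eventually_at_infinity intro!: exI[of _ 1])
  with C(2) have lim: "((\<lambda>\<xi>. \<kappa> \<xi> / (C * \<bar>\<xi>\<bar> powr m)) \<longlongrightarrow> 1) at_infinity"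
    by (rule asymp_equivD_strong)
  have "eventually (\<lambda>\<xi>. 1 / 2 < \<kappa> \<xi> / (C * \<bar>\<xi>\<bar> powr m) \<and> \<kappa> \<xi> / (C * \<bar>\<xi>\<bar> powr m) < 2) at_infinity"
    using order_tendstoD[OF lim, of "1 / 2"] order_tendstoD[OF lim, of 2] by (simp add: eventually_conj_iff)
  then obtain X where X: "\<And>\<xi>. X \<le> \<bar>\<xi>\<bar> \<Longrightarrow>
      1 / 2 < \<kappa> \<xi> / (C * \<bar>\<xi>\<bar> powr m) \<and> \<kappa> \<xi> / (C * \<bar>\<xi>\<bar> powr m) < 2"
    by (auto simp: eventually_at_infinity)
  show thesis
  proof (rule that[of "C / 2" "2 * C" "max X 1"])
    fix \<xi> :: real assume "max X 1 < \<bar>\<xi>\<bar>"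
    then have "0 < C * \<bar>\<xi>\<bar> powr m" "1 / 2 < \<kappa> \<xi> / (C * \<bar>\<xi>\<bar> powr m)" "\<kappa> \<xi> / (C * \<bar>\<xi>\<bar> powr m) < 2"
      using X[of \<xi>] C by auto
    then show "C / 2 * \<bar>\<xi>\<bar> powr m \<le> \<kappa> \<xi>" "\<kappa> \<xi> \<le> 2 * C * \<bar>\<xi>\<bar> powr m"
      by (simp_all add: field_simps)
  qed (use C in auto)
qed

text \<open>The number written \<open>{r}\<close> in the formula for the order of the symbol.\<close>

definition nz :: "real \<Rightarrow> real" where
  "nz r = (if r = 0 then 0 else 1)"

text \<open>
  The leading coefficient of the polynomial \<open>1 - a \<xi>\<^sup>2\<close>.
\<close>

definition leading_coeff :: "real \<Rightarrow> real" where
  "leading_coeff a = (if a = 0 then 1 else - a)"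

lemma quadratic_factor_asymp:
  "(\<lambda>\<xi>. 1 - a * \<xi>\<^sup>2) \<sim>[at_infinity] (\<lambda>\<xi>. leading_coeff a * \<bar>\<xi>\<bar> powr (2 * nz a))"
proof (rule asymp_equivI'_const)
  show "((\<lambda>\<xi>. (1 - a * \<xi>\<^sup>2) / \<bar>\<xi>\<bar> powr (2 * nz a)) \<longlongrightarrow> leading_coeff a) at_infinity"
  proof (rule Lim_transform_eventually)
    have "((\<lambda>\<xi>::real. (inverse \<xi>)\<^sup>2) \<longlongrightarrow> 0\<^sup>2) at_infinity"
      by (intro tendsto_power tendsto_inverse_0)
    from tendsto_diff[OF this tendsto_const[of a]]
    show "((\<lambda>\<xi>. if a = 0 then 1 else (inverse \<xi>)\<^sup>2 - a) \<longlongrightarrow> leading_coeff a) at_infinity"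
      by (cases "a = 0") (simp_all add: leading_coeff_def)
    have "eventually (\<lambda>\<xi>::real. \<xi> \<noteq> 0) at_infinity"
      by (auto simp: eventually_at_infinity intro!: exI[of _ 1])
    then show "\<forall>\<^sub>F \<xi> in at_infinity. (if a = 0 then 1 else (inverse \<xi>)\<^sup>2 - a)
                 = (1 - a * \<xi>\<^sup>2) / \<bar>\<xi>\<bar> powr (2 * nz a)"
    proof eventually_elim
      case (elim \<xi>)
      then show ?case
        by (cases "a = 0") (simp_all add: nz_def diff_divide_distrib power_divide inverse_eq_divide)
    qed
  qed
qed (simp add: leading_coeff_def)

lemma omega_product_nonneg:
  assumes "cond_C1 a b c d \<or> cond_C2 a b c d"
  shows "0 \<le> \<omega>\<^sub>1 a b \<xi> * \<omega>\<^sub>2 c d \<xi>"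
proof -
  have den: "0 < 1 + b * \<xi>\<^sup>2" "0 < 1 + d * \<xi>\<^sup>2"
    using assms by (auto simp: cond_C1_def cond_C2_def intro: add_pos_nonneg)
  have "0 \<le> (1 - a * \<xi>\<^sup>2) * (1 - c * \<xi>\<^sup>2)"
    using assms
  proof
    assume "cond_C1 a b c d"
    then have "a * \<xi>\<^sup>2 \<le> 0" "c * \<xi>\<^sup>2 \<le> 0" by (auto simp: cond_C1_def mult_nonpos_nonneg)
    then show ?thesis by simp
  qed (auto simp: cond_C2_def)
  then show ?thesis using den by (simp add: \<omega>\<^sub>1_def \<omega>\<^sub>2_def)
qed

lemma sgn_omega_eq:
  assumes "cond_C1 a b c d \<or> cond_C2 a b c d"
  shows "sgn (\<omega>\<^sub>1 a b \<xi>) = sgn (\<omega>\<^sub>2 c d \<xi>)"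
proof -
  have den: "0 < 1 + b * \<xi>\<^sup>2" "0 < 1 + d * \<xi>\<^sup>2"
    using assms by (auto simp: cond_C1_def cond_C2_def intro: add_pos_nonneg)
  have "sgn (1 - a * \<xi>\<^sup>2) = sgn (1 - c * \<xi>\<^sup>2)"
    using assms
  proof
    assume "cond_C1 a b c d"
    then have "a * \<xi>\<^sup>2 \<le> 0" "c * \<xi>\<^sup>2 \<le> 0" by (auto simp: cond_C1_def mult_nonpos_nonneg)
    then show ?thesis by simp
  qed (auto simp: cond_C2_def)
  then show ?thesis using den by (simp add: \<omega>\<^sub>1_def \<omega>\<^sub>2_def sgn_divide)
qed

text \<open>
  Each of the four factors \<open>1 - r \<xi>\<^sup>2\<close> of \<open>\<sigma>\<^sup>2\<close> is equivalent to a monomial. The signs of the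
  coefficients make the product of the leading coefficients positive; when \<open>a = c > 0\<close>, both factors
  in the numerator are eventually negative.
\<close>

lemma has_growth_order_sigma:
  assumes C12: "cond_C1 a b c d \<or> cond_C2 a b c d"
  shows "has_growth_order (\<sigma> a b c d) (nz a + nz c - nz b - nz d)"
proof -
  let ?m = "nz a + nz c - nz b - nz d"
  define L where "L = leading_coeff a / leading_coeff (- b) * (leading_coeff c / leading_coeff (- d))"
  have L: "L > 0"
    using C12 by (auto simp: L_def leading_coeff_def cond_C1_def cond_C2_def zero_less_mult_iff zero_less_divide_iff)
  have den: "(\<lambda>\<xi>. 1 + r * \<xi>\<^sup>2) \<sim>[at_infinity] (\<lambda>\<xi>. leading_coeff (- r) * \<bar>\<xi>\<bar> powr (2 * nz r))" for r
    using quadratic_factor_asymp[of "- r"] by (simp add: nz_def)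
  have "(\<lambda>\<xi>. \<omega>\<^sub>1 a b \<xi> * \<omega>\<^sub>2 c d \<xi>) \<sim>[at_infinity]
     (\<lambda>\<xi>. leading_coeff a * \<bar>\<xi>\<bar> powr (2 * nz a) / (leading_coeff (- b) * \<bar>\<xi>\<bar> powr (2 * nz b)) *
          (leading_coeff c * \<bar>\<xi>\<bar> powr (2 * nz c) / (leading_coeff (- d) * \<bar>\<xi>\<bar> powr (2 * nz d))))"
    unfolding \<omega>\<^sub>1_def \<omega>\<^sub>2_def
    by (intro asymp_equiv_mult asymp_equiv_divide quadratic_factor_asymp den)
  also have "\<dots> = (\<lambda>\<xi>. L * \<bar>\<xi>\<bar> powr (2 * ?m))"
    by (simp add: L_def fun_eq_iff powr_add powr_diff right_diff_distrib distrib_left mult_ac)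
  finally have "(\<lambda>\<xi>. (\<omega>\<^sub>1 a b \<xi> * \<omega>\<^sub>2 c d \<xi>) powr (1 / 2)) \<sim>[at_infinity] (\<lambda>\<xi>. (L * \<bar>\<xi>\<bar> powr (2 * ?m)) powr (1 / 2))"
    using L omega_product_nonneg[OF C12] by (intro asymp_equiv_powr_real always_eventually) auto
  moreover have "(L * \<bar>\<xi>\<bar> powr (2 * ?m)) powr (1 / 2) = sqrt L * \<bar>\<xi>\<bar> powr ?m" for \<xi> :: real
  proof -
    have "(L * \<bar>\<xi>\<bar> powr (2 * m)) powr (1 / 2) = sqrt L * \<bar>\<xi>\<bar> powr m" for m
      using L by (simp add: powr_mult powr_powr powr_half_sqrt)
    then show ?thesis .
  qed
  moreover have "(\<omega>\<^sub>1 a b \<xi> * \<omega>\<^sub>2 c d \<xi>) powr (1 / 2) = \<sigma> a b c d \<xi>" for \<xi>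
    using omega_product_nonneg[OF C12] by (simp add: \<sigma>_def powr_half_sqrt)
  ultimately show ?thesis
    using L unfolding has_growth_order_def by (intro exI[of _ "sqrt L"]) auto
qed

section \<open>Decay rates and classification of the systems\<close>

lemma A_eq_coupling_matrix:
  assumes "cond_C1 a b c d \<or> cond_C2 a b c d"
  shows "A 1 a b c d \<xi> = coupling_matrix (\<alpha> b \<xi>) (\<epsilon> d \<xi>) (sgn (\<omega>\<^sub>1 a b \<xi>) * \<xi> * \<sigma> a b c d \<xi>)"
  by (simp add: A_def coupling_matrix_def sgn_omega_eq[OF assms])

text \<open>
  At a zero of \<open>\<omega>\<^sub>1\<close> the sign is \<open>0\<close>, but so is \<open>\<sigma>\<close>.
\<close>

lemma abs_coupling:
  assumes "cond_C1 a b c d \<or> cond_C2 a b c d"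
  shows "\<bar>sgn (\<omega>\<^sub>1 a b \<xi>) * \<xi> * \<sigma> a b c d \<xi>\<bar> = \<bar>\<xi>\<bar> * \<sigma> a b c d \<xi>"
  using omega_product_nonneg[OF assms, of \<xi>]
  by (cases "\<omega>\<^sub>1 a b \<xi> = 0") (auto simp: abs_mult abs_sgn_eq \<sigma>_def)

lemma epsilon_eq_alpha: "\<epsilon> = \<alpha>"
  by (intro ext) (simp add: \<epsilon>_def \<alpha>_def)

lemma alpha_ge_low:
  assumes "0 \<le> b" "b \<le> M" "\<bar>\<xi>\<bar> \<le> \<delta>"
  shows "\<xi>\<^sup>2 / (1 + M * \<delta>\<^sup>2) \<le> \<alpha> b \<xi>"
proof -
  have "\<xi>\<^sup>2 \<le> \<delta>\<^sup>2" using assms(3) abs_le_square_iff[of \<xi> \<delta>] by simp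
  then have "b * \<xi>\<^sup>2 \<le> M * \<delta>\<^sup>2" using assms by (intro mult_mono) auto
  then show ?thesis
    unfolding \<alpha>_def using assms by (intro divide_left_mono) (auto intro!: mult_pos_pos add_pos_nonneg)
qed

lemma alpha_ge_high:
  assumes "0 \<le> b" "b \<le> M" "0 \<le> \<delta>" "\<delta> \<le> \<bar>\<xi>\<bar>"
  shows "\<delta>\<^sup>2 / (1 + M * \<delta>\<^sup>2) \<le> \<alpha> b \<xi>"
proof -
  have sq: "\<delta>\<^sup>2 \<le> \<xi>\<^sup>2" using assms(3,4) abs_le_square_iff[of \<delta> \<xi>] by simp
  have M: "0 \<le> M" using assms by simp
  have pos: "0 < 1 + M * \<delta>\<^sup>2" "0 < 1 + b * \<xi>\<^sup>2"
    using M assms(1) by (auto intro: add_pos_nonneg)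
  have "b * (\<delta>\<^sup>2 * \<xi>\<^sup>2) \<le> M * (\<delta>\<^sup>2 * \<xi>\<^sup>2)"
    using assms(2) by (intro mult_right_mono) auto
  with sq have "\<delta>\<^sup>2 * (1 + b * \<xi>\<^sup>2) \<le> \<xi>\<^sup>2 * (1 + M * \<delta>\<^sup>2)" by (simp add: algebra_simps)
  then show ?thesis unfolding \<alpha>_def using pos by (simp add: pos_divide_le_eq pos_le_divide_eq mult.commute)
qed

lemma alpha_le_square:
  assumes "0 \<le> b" shows "0 \<le> \<alpha> b \<xi>" "\<alpha> b \<xi> \<le> \<xi>\<^sup>2"
proof -
  have "1 \<le> 1 + b * \<xi>\<^sup>2" using assms by simp
  then show "0 \<le> \<alpha> b \<xi>" "\<alpha> b \<xi> \<le> \<xi>\<^sup>2"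
    using divide_left_mono[of 1 "1 + b * \<xi>\<^sup>2" "\<xi>\<^sup>2"] by (simp_all add: \<alpha>_def)
qed

lemma alpha_le_inverse:
  assumes "0 < b" shows "\<alpha> b \<xi> \<le> 1 / b"
  using assms add_pos_nonneg[of 1 "b * \<xi>\<^sup>2"] by (simp add: \<alpha>_def field_simps)

context
  fixes a b c d :: real
  assumes C12: "cond_C1 a b c d \<or> cond_C2 a b c d"
begin

lemma b_nonneg: "0 \<le> b" and d_nonneg: "0 \<le> d"
  using C12 by (auto simp: cond_C1_def cond_C2_def)

lemma low_frequency_decay:
  assumes "\<bar>\<xi>\<bar> \<le> \<delta>" "0 \<le> t"
  shows "opnorm (mexp (- (t *\<^sub>R A 1 a b c d \<xi>))) \<le> exp (- (\<xi>\<^sup>2 / (1 + (b + d) * \<delta>\<^sup>2)) * t)"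
  unfolding A_eq_coupling_matrix[OF C12] epsilon_eq_alpha
  using b_nonneg d_nonneg assms by (intro opnorm_contraction alpha_ge_low) auto

lemma high_frequency_decay:
  assumes "0 \<le> \<delta>" "\<delta> \<le> \<bar>\<xi>\<bar>" "0 \<le> t"
  shows "opnorm (mexp (- (t *\<^sub>R A 1 a b c d \<xi>))) \<le> exp (- (\<delta>\<^sup>2 / (1 + (b + d) * \<delta>\<^sup>2)) * t)"
  unfolding A_eq_coupling_matrix[OF C12] epsilon_eq_alpha
  using b_nonneg d_nonneg assms by (intro opnorm_contraction alpha_ge_high) auto

lemma high_frequency_rate_pos: "0 < \<delta> \<Longrightarrow> 0 < \<delta>\<^sup>2 / (1 + (b + d) * \<delta>\<^sup>2)"
  using b_nonneg d_nonneg by (auto intro!: divide_pos_pos add_pos_nonneg)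

lemma dichotomy_A: "dichotomy (A 1 a b c d) (1 / (1 + (b + d))) 1 1"
  unfolding dichotomy_def
proof (intro conjI allI impI)
  show "0 < 1 / (1 + (b + d))" using b_nonneg d_nonneg by simp
  fix t \<xi> :: real assume t: "0 < t"
  show "opnorm (mexp (- (t *\<^sub>R A 1 a b c d \<xi>))) \<le> 1 * exp (- (1 / (1 + (b + d))) * t * \<xi>\<^sup>2)"
    if "ereal \<bar>\<xi>\<bar> \<le> 1"
    using low_frequency_decay[of \<xi> 1 t] that t by (simp add: one_ereal_def mult_ac)
  show "opnorm (mexp (- (t *\<^sub>R A 1 a b c d \<xi>))) \<le> 1 * exp (- (1 / (1 + (b + d))) * t)"
    if "1 < ereal \<bar>\<xi>\<bar>"
    using high_frequency_decay[of 1 \<xi> t] that t by (simp add: one_ereal_def)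
qed auto

lemma norm_det_A: "cmod (det (A 1 a b c d \<xi>)) = \<alpha> b \<xi> * \<epsilon> d \<xi> + \<xi>\<^sup>2 * (\<sigma> a b c d \<xi>)\<^sup>2"
proof -
  define \<tau> where "\<tau> = sgn (\<omega>\<^sub>1 a b \<xi>) * \<xi> * \<sigma> a b c d \<xi>"
  have "det (A 1 a b c d \<xi>) = of_real (\<alpha> b \<xi> * \<epsilon> d \<xi> + \<tau>\<^sup>2)"
    unfolding A_eq_coupling_matrix[OF C12] \<tau>_def[symmetric]
    by (simp add: coupling_matrix_def det_2 power2_eq_square algebra_simps)
  moreover have "\<tau>\<^sup>2 = \<xi>\<^sup>2 * (\<sigma> a b c d \<xi>)\<^sup>2"
    using abs_coupling[OF C12, of \<xi>] unfolding \<tau>_def by (metis power2_abs power_mult_distrib)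
  moreover have "0 \<le> \<alpha> b \<xi> * \<epsilon> d \<xi>"
    using alpha_le_square b_nonneg d_nonneg by (simp add: epsilon_eq_alpha)
  ultimately show ?thesis by (simp only: norm_of_real) simp
qed

text \<open>
  The decay rate \<open>\<beta> \<xi>\<^sup>2\<close> would require \<open>\<beta>\<^sup>2 \<xi>\<^sup>4 \<le> \<bar>det A(\<xi>)\<bar> = \<alpha> \<epsilon> + \<xi>\<^sup>2 \<sigma>\<^sup>2\<close>. For nonpositive
  order \<open>\<sigma>\<close> is bounded, and one of \<open>\<alpha>\<close> and \<open>\<epsilon>\<close> is bounded while the other one is at most \<open>\<xi>\<^sup>2\<close>.
\<close>

lemma not_KdV_Burgers:
  assumes order: "has_growth_order (\<sigma> a b c d) m" "m \<le> 0" and bd: "0 < b \<or> 0 < d"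
  shows "\<not> KdV_Burgers_class (A 1 a b c d)"
proof
  assume "KdV_Burgers_class (A 1 a b c d)"
  then obtain \<beta> C where "dichotomy (A 1 a b c d) \<beta> C \<infinity>" by (auto simp: KdV_Burgers_class_def)
  then have \<beta>: "\<beta> > 0" and decay: "\<And>t \<xi>. t > 0 \<Longrightarrow>
      opnorm (mexp (- (t *\<^sub>R A 1 a b c d \<xi>))) \<le> C * exp (- (\<beta> * \<xi>\<^sup>2) * t)"
    by (auto simp: dichotomy_def mult_ac)
  obtain K X where K: "0 < K" "1 \<le> X" "\<And>\<xi>. X < \<bar>\<xi>\<bar> \<Longrightarrow> \<sigma> a b c d \<xi> \<le> K * \<bar>\<xi>\<bar> powr m"
    using has_growth_order_bounds[OF order(1)] by metis
  obtain D where D: "\<And>\<xi>. \<alpha> b \<xi> * \<epsilon> d \<xi> \<le> D * \<xi>\<^sup>2"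
  proof (cases "0 < b")
    case True
    have "\<alpha> b \<xi> * \<epsilon> d \<xi> \<le> 1 / b * \<xi>\<^sup>2" for \<xi>
      using True d_nonneg alpha_le_square[of d \<xi>] alpha_le_inverse[OF True, of \<xi>]
      unfolding epsilon_eq_alpha by (intro mult_mono) auto
    then show ?thesis by (rule that)
  next
    case False
    with bd have d: "0 < d" by simp
    have "\<alpha> b \<xi> * \<epsilon> d \<xi> \<le> \<xi>\<^sup>2 * (1 / d)" for \<xi>
      using d b_nonneg alpha_le_square[of b \<xi>] alpha_le_square[of d \<xi>] alpha_le_inverse[OF d, of \<xi>]
      unfolding epsilon_eq_alpha by (intro mult_mono) auto
    then show ?thesis by (intro that[of "1 / d"]) (simp add: mult.commute)
  qed
  have bound: "\<beta>\<^sup>2 * \<xi>\<^sup>2 \<le> D + K\<^sup>2" if \<xi>: "X < \<bar>\<xi>\<bar>" for \<xi>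
  proof -
    have nonzero: "\<xi> \<noteq> 0" using \<xi> K(2) by auto
    have "\<bar>\<xi>\<bar> powr m \<le> \<bar>\<xi>\<bar> powr 0" using \<xi> K(2) order(2) by (intro powr_mono) auto
    then have "K * \<bar>\<xi>\<bar> powr m \<le> K" using nonzero K(1) by simp
    then have "\<sigma> a b c d \<xi> \<le> K" using K(3)[OF \<xi>] by simp
    then have "(\<sigma> a b c d \<xi>)\<^sup>2 \<le> K\<^sup>2"
      using omega_product_nonneg[OF C12, of \<xi>] by (intro power_mono) (auto simp: \<sigma>_def)
    then have "\<xi>\<^sup>2 * (\<sigma> a b c d \<xi>)\<^sup>2 \<le> \<xi>\<^sup>2 * K\<^sup>2" by (intro mult_left_mono) auto
    moreover have "(\<beta> * \<xi>\<^sup>2)\<^sup>2 \<le> cmod (det (A 1 a b c d \<xi>))"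
      using \<beta> decay by (intro decay_rate_sq_le_norm_det) auto
    ultimately have "(\<beta> * \<xi>\<^sup>2)\<^sup>2 \<le> D * \<xi>\<^sup>2 + \<xi>\<^sup>2 * K\<^sup>2"
      using D[of \<xi>] unfolding norm_det_A by linarith
    then have "(\<beta>\<^sup>2 * \<xi>\<^sup>2) * \<xi>\<^sup>2 \<le> (D + K\<^sup>2) * \<xi>\<^sup>2"
      by (simp add: power2_eq_square algebra_simps)
    moreover have "0 < \<xi>\<^sup>2" using \<xi> K(2) by auto
    ultimately show ?thesis by (simp only: mult_le_cancel_right_pos)
  qed
  define \<xi> where "\<xi> = X + 1 + (D + K\<^sup>2) / \<beta>\<^sup>2"
  have "0 \<le> D + K\<^sup>2" using bound[of "X + 1"] K(2) by (smt (verit) zero_le_mult_iff zero_le_power2)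
  then have frac: "0 \<le> (D + K\<^sup>2) / \<beta>\<^sup>2" by simp
  have "\<xi> * 1 \<le> \<xi> * \<xi>" using K(2) frac by (intro mult_left_mono) (auto simp: \<xi>_def)
  then have "(D + K\<^sup>2) / \<beta>\<^sup>2 < \<xi>\<^sup>2" using K(2) by (simp add: \<xi>_def power2_eq_square)
  then have "D + K\<^sup>2 < \<beta>\<^sup>2 * \<xi>\<^sup>2" using \<beta> by (simp add: pos_divide_less_eq mult.commute)
  moreover have "X < \<bar>\<xi>\<bar>" using frac K(2) by (simp add: \<xi>_def)
  ultimately show False using bound[of \<xi>] by simp
qed

text \<open>
  Unless \<open>b = d = 0\<close>, an order of at least \<open>1\<close> leaves only the order \<open>1\<close> with \<open>a\<close> and \<open>c\<close> nonzero and
  exactly one of \<open>b\<close> and \<open>d\<close> zero, so one component has the full damping \<open>\<xi>\<^sup>2\<close> and the coupling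
  \<open>\<bar>\<xi>\<bar> \<sigma>\<close> is comparable to \<open>\<xi>\<^sup>2\<close>.
\<close>

lemma parabolic_high_frequency_decay:
  assumes order: "nz a + nz c - nz b - nz d \<ge> 1"
  obtains \<delta>M \<beta> C where "0 < \<delta>M" "0 < \<beta>" "1 \<le> C"
    "\<And>\<xi> t. \<delta>M < \<bar>\<xi>\<bar> \<Longrightarrow> 0 < t \<Longrightarrow> opnorm (mexp (- (t *\<^sub>R A 1 a b c d \<xi>))) \<le> C * exp (- \<beta> * \<xi>\<^sup>2 * t)"
proof (cases "b = 0 \<and> d = 0")
  case True
  show ?thesis
  proof (rule that[of 1 1 1])
    fix \<xi> t :: real assume "0 < t"
    with True low_frequency_decay[of \<xi> "\<bar>\<xi>\<bar>" t]
    show "opnorm (mexp (- (t *\<^sub>R A 1 a b c d \<xi>))) \<le> 1 * exp (- 1 * \<xi>\<^sup>2 * t)" by simp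
  qed auto
next
  case False
  then have m: "nz a + nz c - nz b - nz d = 1" and bd: "b = 0 \<or> d = 0"
    using order by (auto simp: nz_def split: if_splits)
  obtain k K X where k: "0 < k" and K: "0 < K" and X: "1 \<le> X"
    and lower: "\<And>\<xi>. X < \<bar>\<xi>\<bar> \<Longrightarrow> k * \<bar>\<xi>\<bar> powr 1 \<le> \<sigma> a b c d \<xi>"
    and upper: "\<And>\<xi>. X < \<bar>\<xi>\<bar> \<Longrightarrow> \<sigma> a b c d \<xi> \<le> K * \<bar>\<xi>\<bar> powr 1"
    using has_growth_order_bounds[OF has_growth_order_sigma[OF C12]] unfolding m by metis
  define g where "g = 1 / (2 + 2 * K + 4 / k)"
  have g: "0 < g" using k K by (simp add: g_def add_pos_pos)
  show ?thesis
  proof (rule that[of X "g * k / 3" 2])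
    fix \<xi> t :: real assume \<xi>: "X < \<bar>\<xi>\<bar>" and t: "0 < t"
    have sq: "\<bar>\<xi>\<bar> * (s * \<bar>\<xi>\<bar> powr 1) = s * \<xi>\<^sup>2" for s
      by (simp add: power2_eq_square mult.left_commute)
    have "k * \<xi>\<^sup>2 \<le> \<bar>\<xi>\<bar> * \<sigma> a b c d \<xi>" "\<bar>\<xi>\<bar> * \<sigma> a b c d \<xi> \<le> K * \<xi>\<^sup>2"
      using lower[OF \<xi>] upper[OF \<xi>] unfolding sq[symmetric] by (auto intro: mult_left_mono)
    moreover have "\<alpha> b \<xi> = \<xi>\<^sup>2 \<or> \<alpha> d \<xi> = \<xi>\<^sup>2" using bd by (auto simp: \<alpha>_def)
    moreover have "0 < \<xi>\<^sup>2" using \<xi> X by auto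
    ultimately show "opnorm (mexp (- (t *\<^sub>R A 1 a b c d \<xi>))) \<le> 2 * exp (- (g * k / 3) * \<xi>\<^sup>2 * t)"
      unfolding A_eq_coupling_matrix[OF C12] epsilon_eq_alpha
      using k K t b_nonneg d_nonneg
      by (intro opnorm_parabolic_decay[OF k K g_def]) (auto simp: abs_coupling[OF C12] alpha_le_square)
  qed (use g k X in auto)
qed

text \<open>
  For \<open>\<bar>\<xi>\<bar> \<le> \<delta>M\<close> the contraction estimate already has a rate proportional to \<open>\<xi>\<^sup>2\<close>.
\<close>

lemma KdV_Burgers_of_high_frequency_decay:
  assumes "0 < \<delta>M" "0 < \<beta>" "1 \<le> C" and high: "\<And>\<xi> t. \<delta>M < \<bar>\<xi>\<bar> \<Longrightarrow> 0 < t \<Longrightarrow>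
       opnorm (mexp (- (t *\<^sub>R A 1 a b c d \<xi>))) \<le> C * exp (- \<beta> * \<xi>\<^sup>2 * t)"
  shows "KdV_Burgers_class (A 1 a b c d)"
proof -
  define \<beta>\<^sub>0 where "\<beta>\<^sub>0 = 1 / (1 + (b + d) * \<delta>M\<^sup>2)"
  have \<beta>\<^sub>0: "0 < \<beta>\<^sub>0" unfolding \<beta>\<^sub>0_def using b_nonneg d_nonneg by (auto intro!: divide_pos_pos add_pos_nonneg)
  have "opnorm (mexp (- (t *\<^sub>R A 1 a b c d \<xi>))) \<le> C * exp (- (min \<beta> \<beta>\<^sub>0) * t * \<xi>\<^sup>2)" if t: "0 < t" for t \<xi>
  proof (cases "\<delta>M < \<bar>\<xi>\<bar>")
    case True
    have "min \<beta> \<beta>\<^sub>0 * (t * \<xi>\<^sup>2) \<le> \<beta> * (t * \<xi>\<^sup>2)" using t by (intro mult_right_mono) auto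
    then have "C * exp (- \<beta> * \<xi>\<^sup>2 * t) \<le> C * exp (- (min \<beta> \<beta>\<^sub>0) * t * \<xi>\<^sup>2)"
      using assms(3) by (intro mult_left_mono) (auto simp: mult_ac)
    with high[OF True t] show ?thesis by simp
  next
    case False
    have "min \<beta> \<beta>\<^sub>0 * (t * \<xi>\<^sup>2) \<le> \<beta>\<^sub>0 * (t * \<xi>\<^sup>2)" using t by (intro mult_right_mono) auto
    then have "1 * exp (- (\<xi>\<^sup>2 / (1 + (b + d) * \<delta>M\<^sup>2)) * t) \<le> C * exp (- (min \<beta> \<beta>\<^sub>0) * t * \<xi>\<^sup>2)"
      using assms(3) by (intro mult_mono) (auto simp: \<beta>\<^sub>0_def mult_ac)
    with low_frequency_decay[of \<xi> \<delta>M t] False t show ?thesis by simp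
  qed
  then show ?thesis
    unfolding KdV_Burgers_class_def dichotomy_def using assms \<beta>\<^sub>0
    by (intro exI[of _ "min \<beta> \<beta>\<^sub>0"] exI[of _ C]) auto
qed

end

theorem proposition3p3:
  fixes a b c d \<nu> :: real
  assumes C0: "cond_C0 a b c d"
    and C12: "cond_C1 a b c d \<or> cond_C2 a b c d"
    and nu: "\<nu> = 1"
  shows "(\<forall>\<delta>>0. \<exists>\<beta>>0. \<forall>Y0 Y0_hat. L2 Y0 \<longrightarrow> has_L2_fourier_vec Y0 Y0_hat \<longrightarrow>
            ess_support Y0_hat \<subseteq> UNIV - {-\<delta>..\<delta>} \<longrightarrow>
            (\<forall>t>0. energy \<nu> a b c d Y0_hat t \<le> ennreal (exp (- 2 * \<beta> * t) * (L2_norm Y0)\<^sup>2)))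
      \<and> (growth_order (\<sigma> a b c d) \<le> 0 \<longrightarrow>
            BBM_Burgers_class (A \<nu> a b c d) \<and>
            (\<exists>\<delta>M>0. \<exists>\<beta>>0. \<exists>C>0. \<forall>\<xi>. \<bar>\<xi>\<bar> > \<delta>M \<longrightarrow>
               (\<forall>t>0. opnorm (mexp (- (t *\<^sub>R A \<nu> a b c d \<xi>))) \<le> C * exp (- \<beta> * t))))
      \<and> (growth_order (\<sigma> a b c d) \<ge> 1 \<longrightarrow>
            KdV_Burgers_class (A \<nu> a b c d) \<and>
            (\<exists>\<delta>M>0. \<exists>\<beta>>0. \<exists>C>0. \<forall>\<xi>. \<bar>\<xi>\<bar> > \<delta>M \<longrightarrow>
               (\<forall>t>0. opnorm (mexp (- (t *\<^sub>R A \<nu> a b c d \<xi>))) \<le> C * exp (- \<beta> * \<xi>\<^sup>2 * t))))"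
proof -
  let ?m = "nz a + nz c - nz b - nz d"
  have order: "growth_order (\<sigma> a b c d) = ?m"
    by (rule growth_order_eqI[OF has_growth_order_sigma[OF C12]])
  have energy: "\<exists>\<beta>>0. \<forall>Y0 Y0_hat. L2 Y0 \<longrightarrow> has_L2_fourier_vec Y0 Y0_hat \<longrightarrow>
            ess_support Y0_hat \<subseteq> UNIV - {-\<delta>..\<delta>} \<longrightarrow>
            (\<forall>t>0. energy 1 a b c d Y0_hat t \<le> ennreal (exp (- 2 * \<beta> * t) * (L2_norm Y0)\<^sup>2))"
    if "\<delta> > 0" for \<delta>
  proof (intro exI conjI allI impI)
    show "0 < \<delta>\<^sup>2 / (1 + (b + d) * \<delta>\<^sup>2)" by (rule high_frequency_rate_pos[OF C12 that])
    fix Y0 Y0_hat :: "real \<Rightarrow> complex^2" and t :: real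
    assume Y0: "L2 Y0" "has_L2_fourier_vec Y0 Y0_hat" "ess_support Y0_hat \<subseteq> UNIV - {-\<delta>..\<delta>}"
      and t: "0 < t"
    show "energy 1 a b c d Y0_hat t
        \<le> ennreal (exp (- 2 * (\<delta>\<^sup>2 / (1 + (b + d) * \<delta>\<^sup>2)) * t) * (L2_norm Y0)\<^sup>2)"
      by (rule energy_decay[OF Y0], rule high_frequency_decay[OF C12]) (use that t in auto)
  qed
  have BBM: "BBM_Burgers_class (A 1 a b c d)" if "?m \<le> 0"
  proof -
    \<comment> \<open>Otherwise the order is \<open>{a} + {c}\<close>, so all coefficients vanish, but their sum is \<open>1/3\<close>.\<close>
    have "0 < b \<or> 0 < d"
    proof (rule ccontr)
      assume "\<not> (0 < b \<or> 0 < d)"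
      with b_nonneg[OF C12] d_nonneg[OF C12] have "b = 0" "d = 0" by auto
      with that have "a = 0" "c = 0" by (auto simp: nz_def split: if_splits)
      with \<open>b = 0\<close> \<open>d = 0\<close> C0 show False by (simp add: cond_C0_def)
    qed
    with that show ?thesis
      using dichotomy_A[OF C12] not_KdV_Burgers[OF C12 has_growth_order_sigma[OF C12]]
      unfolding BBM_Burgers_class_def by blast
  qed
  have BBM_high: "\<exists>\<delta>M>0. \<exists>\<beta>>0. \<exists>C>0. \<forall>\<xi>. \<bar>\<xi>\<bar> > \<delta>M \<longrightarrow>
               (\<forall>t>0. opnorm (mexp (- (t *\<^sub>R A 1 a b c d \<xi>))) \<le> C * exp (- \<beta> * t))"
    using high_frequency_rate_pos[OF C12, of 1] high_frequency_decay[OF C12, of 1]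
    by (intro exI[of _ 1] exI[of _ "1\<^sup>2 / (1 + (b + d) * 1\<^sup>2)"] conjI) auto
  have KdV: "KdV_Burgers_class (A 1 a b c d) \<and> (\<exists>\<delta>M>0. \<exists>\<beta>>0. \<exists>C>0. \<forall>\<xi>. \<bar>\<xi>\<bar> > \<delta>M \<longrightarrow>
               (\<forall>t>0. opnorm (mexp (- (t *\<^sub>R A 1 a b c d \<xi>))) \<le> C * exp (- \<beta> * \<xi>\<^sup>2 * t)))" if m: "1 \<le> ?m"
  proof -
    obtain \<delta>M \<beta> C where *: "0 < \<delta>M" "0 < \<beta>" "1 \<le> C" "\<And>\<xi> t. \<delta>M < \<bar>\<xi>\<bar> \<Longrightarrow> 0 < t \<Longrightarrow>
        opnorm (mexp (- (t *\<^sub>R A 1 a b c d \<xi>))) \<le> C * exp (- \<beta> * \<xi>\<^sup>2 * t)"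
      using parabolic_high_frequency_decay[OF C12 m] by metis
    show ?thesis
      using * KdV_Burgers_of_high_frequency_decay[OF C12 *]
      by (intro conjI exI[of _ \<delta>M] exI[of _ \<beta>] exI[of _ C]) auto
  qed
  show ?thesis unfolding nu order using energy BBM BBM_high KdV by blast
qed

end
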